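(* For every tree poset $T$, \[\mathrm{La}^*_R(n,T)=\bigl(|T|-1+o(1)\bigr)\binom{n}{\lfloor n/2\rfloor}\] as $n\to\infty$.
   Context: All posets are finite. $B_n$ is the poset $(2^{[n]},\subseteq)$. A subfamily of a family of sets (or subset of a poset) is a copy of a poset $P$ if, ordered by inclusion (resp. by the induced order), it is isomorphic to $P$. A coloring of a family $\mathcal{F}$ of sets is proper if $F\subsetneq F'$ in $\mathcal{F}$ implies $F$ and $F'$ get different colors; a copy is rainbow if all its members receive distinct colors. $\mathrm{La}^*_R(n,P)$ is the maximum size of a family $\mathcal{F}\subseteq 2^{[n]}$ that admits a proper coloring with no rainbow copy of $P$ (equivalently, the maximum size of a union of antichains $A^1,\dots,A^m$ in $B_n$ with no copy of $P$ whose elements come from pairwise distinct $A^i$). The (unoriented) Hasse diagram of a poset has an edge between $x$ and $y$ whenever one covers the other; a tree poset is a poset whose Hasse diagram is a tree. *)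

theory Defs
  imports Complex_Main "HOL-Library.Landau_Symbols"
begin

text \<open>
  A poset is a pair of a carrier set \<open>P\<close> and a reflexive order relation \<open>r\<close> on it, as in
  \<^const>\<open>partial_order_on\<close>.
\<close>

definition poset_less :: "'a rel \<Rightarrow> 'a \<Rightarrow> 'a \<Rightarrow> bool" where
  "poset_less r x y \<longleftrightarrow> (x, y) \<in> r \<and> x \<noteq> y"

definition poset_covered_by :: "'a set \<Rightarrow> 'a rel \<Rightarrow> 'a \<Rightarrow> 'a \<Rightarrow> bool" where
  "poset_covered_by P r x y \<longleftrightarrow>
     x \<in> P \<and> y \<in> P \<and> poset_less r x y \<and> \<not> (\<exists>z\<in>P. poset_less r x z \<and> poset_less r z y)"

definition hasse_edge :: "'a set \<Rightarrow> 'a rel \<Rightarrow> 'a \<Rightarrow> 'a \<Rightarrow> bool" where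
  "hasse_edge P r x y \<longleftrightarrow> poset_covered_by P r x y \<or> poset_covered_by P r y x"

text \<open>
  Undirected simple graphs are given by a vertex set and a symmetric irreflexive adjacency
  predicate. The empty graph is not a tree. The AFP notion \<open>tree\<close> of digraphs is not applicable:
  it forbids directed cycles only, and in a symmetric digraph it counts every edge as a cycle
  of length two.
\<close>

definition ugraph_cycle :: "('a \<Rightarrow> 'a \<Rightarrow> bool) \<Rightarrow> 'a list \<Rightarrow> bool" where
  "ugraph_cycle E xs \<longleftrightarrow>
     length xs \<ge> 3 \<and> distinct xs \<and> successively E xs \<and> E (last xs) (hd xs)"

definition ugraph_connected :: "'a set \<Rightarrow> ('a \<Rightarrow> 'a \<Rightarrow> bool) \<Rightarrow> bool" where
  "ugraph_connected V E \<longleftrightarrow> V \<noteq> {} \<and> (\<forall>x\<in>V. \<forall>y\<in>V. E\<^sup>*\<^sup>* x y)"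

definition ugraph_tree :: "'a set \<Rightarrow> ('a \<Rightarrow> 'a \<Rightarrow> bool) \<Rightarrow> bool" where
  "ugraph_tree V E \<longleftrightarrow> ugraph_connected V E \<and> \<not> (\<exists>xs. ugraph_cycle E xs)"

definition tree_poset :: "'a set \<Rightarrow> 'a rel \<Rightarrow> bool" where
  "tree_poset P r \<longleftrightarrow> finite P \<and> partial_order_on P r \<and> ugraph_tree P (hasse_edge P r)"

definition poset_copy :: "'a set \<Rightarrow> 'a rel \<Rightarrow> 'b set set \<Rightarrow> bool" where
  "poset_copy P r G \<longleftrightarrow>
     (\<exists>f. bij_betw f P G \<and> (\<forall>x\<in>P. \<forall>y\<in>P. (x, y) \<in> r \<longleftrightarrow> f x \<subseteq> f y))"

definition proper_family_coloring :: "'b set set \<Rightarrow> ('b set \<Rightarrow> 'c) \<Rightarrow> bool" where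
  "proper_family_coloring \<F> c \<longleftrightarrow> (\<forall>F\<in>\<F>. \<forall>F'\<in>\<F>. F \<subset> F' \<longrightarrow> c F \<noteq> c F')"

definition has_rainbow_copy :: "'a set \<Rightarrow> 'a rel \<Rightarrow> 'b set set \<Rightarrow> ('b set \<Rightarrow> 'c) \<Rightarrow> bool" where
  "has_rainbow_copy P r \<F> c \<longleftrightarrow> (\<exists>G\<subseteq>\<F>. poset_copy P r G \<and> inj_on c G)"

text \<open>
  Natural numbers suffice as colors, since the families are finite. The number of colors is not
  bounded. For nonempty \<open>P\<close> the empty family qualifies, so the maximum is taken over a nonempty
  finite set; for empty \<open>P\<close> the value is unspecified.
\<close>

definition La_star_R :: "nat \<Rightarrow> 'a set \<Rightarrow> 'a rel \<Rightarrow> nat" where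
  "La_star_R n P r =
     Max {card \<F> | \<F> :: nat set set. \<F> \<subseteq> Pow {1..n} \<and>
       (\<exists>c :: nat set \<Rightarrow> nat. proper_family_coloring \<F> c \<and> \<not> has_rainbow_copy P r \<F> c)}"

end

theory Submission
  imports Defs "HOL-Combinatorics.Multiset_Permutations" "HOL-Probability.Hoeffding"
    "HOL-Real_Asymp.Real_Asymp"
begin

text \<open>
  The lower bound is given by \<open>|T| - 1\<close> consecutive middle layers, colored by cardinality.

  For the upper bound let \<open>k = |T|\<close>. If \<open>\<F>\<close> has Lubell mass at least \<open>k - 1 + \<epsilon>\<close>, then a random full
  chain carries on average at least \<open>\<epsilon>\<close> blocks of \<open>k\<close> consecutive members of \<open>\<F>\<close>. The coloring
  being proper, each block is rainbow. Assigning to every color a random position below \<open>k\<close>, a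
  proportion \<open>1/k^k\<close> of the blocks has at each position \<open>p\<close> a color that was assigned to \<open>p\<close>.
  After pruning, every surviving member at every position lies in such blocks on a positive
  fraction of the chains through it. Now fix a linear extension of \<open>T\<close> and embed \<open>T\<close> one leaf at a
  time, the \<open>p\<close>-th element at position \<open>p\<close>: distinct positions force distinct colors, and since
  \<open>\<F>\<close> may be assumed to lie in the layers \<open>n/2 \<plusminus> \<delta>n\<close>, a random chain through the parent of the new
  leaf avoids unwanted comparabilities except with small probability.
\<close>

section \<open>Tree posets\<close>

lemma distinct_path_of_rtranclp:
  assumes "R\<^sup>*\<^sup>* a b"
  shows "\<exists>xs. xs \<noteq> [] \<and> hd xs = a \<and> last xs = b \<and> successively R xs \<and> distinct xs"
  using assms
proof (induction rule: rtranclp_induct)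
  case base
  show ?case by (rule exI[of _ "[a]"]) simp
next
  case (step b c)
  then obtain xs where xs: "xs \<noteq> []" "hd xs = a" "last xs = b" "successively R xs" "distinct xs"
    by blast
  show ?case
  proof (cases "c \<in> set xs")
    \<comment> \<open>The path already visits \<open>c\<close>, so it is cut at that visit instead
      of being prolonged.\<close>
    case True
    then obtain us vs where uv: "xs = us @ c # vs" by (meson split_list)
    have "hd (us @ [c]) = a" using xs(2) uv by (cases us) auto
    moreover have "successively R (us @ [c])" using xs(4) uv
      by (auto simp: successively_append_iff successively_Cons)
    moreover have "distinct (us @ [c])" using xs(5) uv by auto
    ultimately show ?thesis by (intro exI[of _ "us @ [c]"]) simp
  next
    case False
    then show ?thesis using xs step.hyps
      by (intro exI[of _ "xs @ [c]"]) (auto simp: successively_append_iff)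
  qed
qed

text \<open>A repetition-free path from \<open>y\<close> to \<open>x\<close> that avoids the edge
  \<open>xy\<close> has at least three vertices, and that edge closes it to a cycle. Hence deleting
  an edge of a tree separates its ends.\<close>

lemma ugraph_cycle_of_detour:
  assumes "E x y" "x \<noteq> y" "(\<lambda>a b. E a b \<and> {a, b} \<noteq> {x, y})\<^sup>*\<^sup>* y x"
  shows "\<exists>xs. ugraph_cycle E xs"
proof -
  obtain xs where xs: "xs \<noteq> []" "hd xs = y" "last xs = x" "distinct xs"
    "successively (\<lambda>a b. E a b \<and> {a, b} \<noteq> {x, y}) xs"
    using distinct_path_of_rtranclp[OF assms(3)] by auto
  have "length xs \<ge> 3"
  proof (rule ccontr)
    assume "\<not> length xs \<ge> 3"
    then consider a where "xs = [a]" | a b where "xs = [a, b]"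
      using xs(1) by (cases xs; cases "tl xs") (auto simp: Suc_le_eq numeral_eq_Suc)
    then show False using xs(2,3,5) assms(2) by cases auto
  qed
  moreover have "successively E xs" using xs(5) by (rule successively_mono) auto
  ultimately show ?thesis unfolding ugraph_cycle_def using xs assms(1) by blast
qed

lemma partial_order_on_facts:
  assumes "partial_order_on T r"
  shows "r \<subseteq> T \<times> T" "\<And>x. x \<in> T \<Longrightarrow> (x, x) \<in> r" "trans r" "antisym r"
  using assms unfolding partial_order_on_def preorder_on_def refl_on_def by auto

text \<open>Induction on the size of the interval from \<open>u\<close> to \<open>v\<close>: an
  intermediate \<open>z\<close> splits it into two smaller intervals, the lower one lacking
  \<open>v\<close> and the upper one lacking \<open>u\<close>.\<close>

lemma cover_walk:
  assumes "finite T" "partial_order_on T r" "(u, v) \<in> r"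
  shows "(poset_covered_by T r)\<^sup>*\<^sup>* u v"
  using assms(3)
proof (induction "card {z. (u, z) \<in> r \<and> (z, v) \<in> r}" arbitrary: u v rule: less_induct)
  case less
  note po = partial_order_on_facts[OF assms(2)]
  have uv: "u \<in> T" "v \<in> T" using po less.prems by auto
  consider "u = v" | "poset_covered_by T r u v"
    | z where "z \<in> T" "poset_less r u z" "poset_less r z v"
    using less.prems uv unfolding poset_covered_by_def poset_less_def by auto
  then show ?case
  proof cases
    case 3
    have fin: "finite {z. (u, z) \<in> r \<and> (z, v) \<in> r}" for u v
      by (rule finite_subset[OF _ assms(1)]) (use po in auto)
    have z: "(u, z) \<in> r" "u \<noteq> z" "(z, v) \<in> r" "z \<noteq> v"
      using 3 by (auto simp: poset_less_def)
    have "{w. (u, w) \<in> r \<and> (w, z) \<in> r} \<subset> {w. (u, w) \<in> r \<and> (w, v) \<in> r}"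
    proof
      show "{w. (u, w) \<in> r \<and> (w, z) \<in> r} \<subseteq> {w. (u, w) \<in> r \<and> (w, v) \<in> r}"
        using z po(3) by (auto dest: transD)
      show "{w. (u, w) \<in> r \<and> (w, z) \<in> r} \<noteq> {w. (u, w) \<in> r \<and> (w, v) \<in> r}"
        using z po less.prems uv by (auto dest: antisymD)
    qed
    then have 1: "(poset_covered_by T r)\<^sup>*\<^sup>* u z"
      by (intro less.hyps psubset_card_mono fin z)
    have "{w. (z, w) \<in> r \<and> (w, v) \<in> r} \<subset> {w. (u, w) \<in> r \<and> (w, v) \<in> r}"
    proof
      show "{w. (z, w) \<in> r \<and> (w, v) \<in> r} \<subseteq> {w. (u, w) \<in> r \<and> (w, v) \<in> r}"
        using z po(3) by (auto dest: transD)
      show "{w. (z, w) \<in> r \<and> (w, v) \<in> r} \<noteq> {w. (u, w) \<in> r \<and> (w, v) \<in> r}"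
        using z po less.prems uv by (auto dest: antisymD)
    qed
    then have 2: "(poset_covered_by T r)\<^sup>*\<^sup>* z v"
      by (intro less.hyps psubset_card_mono fin z)
    show ?thesis using 1 2 by simp
  qed auto
qed

text \<open>Only the steps that occur on walks from \<open>a\<close> to \<open>b\<close> have to be
  steps of \<open>E'\<close>. For cover walks, reachability from \<open>a\<close> means lying above
  \<open>a\<close>, which is how a forbidden edge gets excluded.\<close>

lemma walk_avoiding:
  assumes "E\<^sup>*\<^sup>* a b" "\<And>u v. E\<^sup>*\<^sup>* a u \<Longrightarrow> E u v \<Longrightarrow> E\<^sup>*\<^sup>* v b \<Longrightarrow> E' u v"
  shows "E'\<^sup>*\<^sup>* a b"
  using assms
proof (induction rule: converse_rtranclp_induct)
  case (step y z)
  have "E' y z" using step.hyps step.prems by auto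
  moreover have "E'\<^sup>*\<^sup>* z b" using step by (meson converse_rtranclp_into_rtranclp)
  ultimately show ?case by (rule converse_rtranclp_into_rtranclp)
qed auto

lemma rtranclp_covered_by_le:
  assumes "partial_order_on T r" "(poset_covered_by T r)\<^sup>*\<^sup>* u v" "u \<in> T"
  shows "(u, v) \<in> r"
  using assms(2)
proof (induction rule: rtranclp_induct)
  case base
  then show ?case using assms by (simp add: partial_order_on_facts)
next
  case (step y z)
  then show ?case using partial_order_on_facts(3)[OF assms(1)]
    by (auto simp: poset_covered_by_def poset_less_def dest: transD)
qed

section \<open>Building a tree poset leaf by leaf\<close>

text \<open>This is all that the embedding has to know about a new leaf; the Hasse diagram is no
  longer mentioned. A leaf hanging below \<open>y\<close> is treated by passing to the converse of
  \<open>r\<close>.\<close>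

definition leaf_above :: "'a rel \<Rightarrow> 'a set \<Rightarrow> 'a \<Rightarrow> 'a \<Rightarrow> bool" where
  "leaf_above r S y x \<longleftrightarrow> (y, x) \<in> r \<and> (\<forall>w\<in>S. ((w, x) \<in> r \<longleftrightarrow> (w, y) \<in> r) \<and> (x, w) \<notin> r)"

lemma hasse_edge_converse: "hasse_edge T (r\<inverse>) = hasse_edge T r"
  unfolding hasse_edge_def poset_covered_by_def poset_less_def by (intro ext) auto

text \<open>Deleting the edge \<open>xy\<close> separates \<open>x\<close> from \<open>y\<close>,
  and \<open>S\<close>, connected without that edge, lies on the side of \<open>y\<close>. An
  element of \<open>S\<close> violating one of the claims would give a cover walk between it and
  \<open>x\<close> that avoids the edge, hence a cycle.\<close>

lemma leaf_above_if_covered_by: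
  assumes T: "finite T" "partial_order_on T r" "\<not> (\<exists>xs. ugraph_cycle (hasse_edge T r) xs)"
    and S: "S \<subseteq> T" "\<And>a b. a \<in> S \<Longrightarrow> b \<in> S \<Longrightarrow> (\<lambda>a b. hasse_edge T r a b \<and> a \<in> S \<and> b \<in> S)\<^sup>*\<^sup>* a b"
    and xy: "x \<notin> S" "y \<in> S" "poset_covered_by T r y x"
  shows "leaf_above r S y x"
proof -
  note po = partial_order_on_facts[OF T(2)]
  let ?E = "hasse_edge T r"
  let ?E' = "\<lambda>a b. ?E a b \<and> {a, b} \<noteq> {x, y}"
  have yx: "(y, x) \<in> r" "y \<noteq> x" "x \<in> T"
    using xy by (auto simp: poset_covered_by_def poset_less_def)
  have E: "?E x y" using xy by (simp add: hasse_edge_def)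
  have no: "\<not> ?E'\<^sup>*\<^sup>* y x" using ugraph_cycle_of_detour[of "hasse_edge T r" x y] E yx T(3) by blast
  have symE: "symp ?E'" by (auto simp: symp_def hasse_edge_def insert_commute)
  have inS: "?E'\<^sup>*\<^sup>* a b" if "a \<in> S" "b \<in> S" for a b
    using S(2)[OF that]
    by (rule rtranclp_mono[THEN predicate2D, rotated]) (use xy in \<open>auto simp: doubleton_eq_iff\<close>)
  have *: "(w, y) \<in> r" if w: "w \<in> S" "(w, x) \<in> r" for w
  proof (rule ccontr)
    assume nwy: "(w, y) \<notin> r"
    have "?E'\<^sup>*\<^sup>* w x"
    proof (rule walk_avoiding[OF cover_walk[OF T(1,2) w(2)]])
      fix u v assume u: "(poset_covered_by T r)\<^sup>*\<^sup>* w u" "poset_covered_by T r u v"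
      have "w \<in> T" using w S(1) by auto
      then have wu: "(w, u) \<in> r" using rtranclp_covered_by_le[OF T(2) u(1)] by simp
      have uv: "(u, v) \<in> r" "u \<noteq> v" using u(2) by (auto simp: poset_covered_by_def poset_less_def)
      have "\<not> (u = y \<and> v = x)" using wu nwy by auto
      moreover have "\<not> (u = x \<and> v = y)" using uv yx po(4) by (auto dest: antisymD)
      ultimately have "{u, v} \<noteq> {x, y}" by (auto simp: doubleton_eq_iff)
      then show "?E' u v" using u(2) by (auto simp: hasse_edge_def)
    qed
    with inS[OF xy(2) w(1)] no show False by (meson rtranclp_trans)
  qed
  have **: "(x, w) \<notin> r" if w: "w \<in> S" for w
  proof
    assume xw: "(x, w) \<in> r"
    have "?E'\<^sup>*\<^sup>* x w"
    proof (rule walk_avoiding[OF cover_walk[OF T(1,2) xw]])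
      fix u v assume u: "(poset_covered_by T r)\<^sup>*\<^sup>* x u" "poset_covered_by T r u v"
      have xu: "(x, u) \<in> r" using rtranclp_covered_by_le[OF T(2) u(1)] yx by simp
      have uv: "(u, v) \<in> r" "u \<noteq> v" using u(2) by (auto simp: poset_covered_by_def poset_less_def)
      have "u \<noteq> y" using xu yx po(4) by (auto dest: antisymD)
      moreover have "v \<noteq> y" using xu uv yx po(3,4) by (metis antisymD transD)
      ultimately have "{u, v} \<noteq> {x, y}" by (auto simp: doubleton_eq_iff)
      then show "?E' u v" using u(2) by (auto simp: hasse_edge_def)
    qed
    moreover have "?E'\<^sup>*\<^sup>* w y" by (rule inS[OF w xy(2)])
    ultimately have "?E'\<^sup>*\<^sup>* x y" by simp
    then show False using no sympD[OF symp_rtranclp[OF symE]] by blast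
  qed
  show ?thesis unfolding leaf_above_def
    using yx(1) * ** po(3) by (blast dest: transD)
qed

text \<open>A maximal connected subset with \<open>P\<close> must be all of \<open>T\<close>:
  otherwise a walk in the Hasse diagram leaves it along some edge, and the outer end of that edge
  can be added as a leaf, above or below.\<close>

lemma tree_poset_leaf_induct [consumes 1, case_names singleton insert_above insert_below]:
  assumes "tree_poset T r"
    and singleton: "\<And>x. x \<in> T \<Longrightarrow> P {x}"
    and above: "\<And>S x y. S \<subseteq> T \<Longrightarrow> x \<in> T - S \<Longrightarrow> y \<in> S \<Longrightarrow> leaf_above r S y x \<Longrightarrow> P S \<Longrightarrow> P (insert x S)"
    and below: "\<And>S x y. S \<subseteq> T \<Longrightarrow> x \<in> T - S \<Longrightarrow> y \<in> S \<Longrightarrow> leaf_above (r\<inverse>) S y x \<Longrightarrow> P S \<Longrightarrow> P (insert x S)"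
  shows "P T"
proof -
  let ?E = "hasse_edge T r"
  let ?conn = "\<lambda>S. \<forall>a\<in>S. \<forall>b\<in>S. (\<lambda>a b. ?E a b \<and> a \<in> S \<and> b \<in> S)\<^sup>*\<^sup>* a b"
  \<comment> \<open>The walks must stay inside \<open>S\<close>, since it is this inner connectivity
    that \<open>leaf_above_if_covered_by\<close> asks for.\<close>
  define C where "C = {S. S \<subseteq> T \<and> S \<noteq> {} \<and> ?conn S \<and> P S}"
  have T: "finite T" "partial_order_on T r" "\<not> (\<exists>xs. ugraph_cycle ?E xs)" "T \<noteq> {}"
    "\<And>x y. x \<in> T \<Longrightarrow> y \<in> T \<Longrightarrow> ?E\<^sup>*\<^sup>* x y"
    using assms(1) unfolding tree_poset_def ugraph_tree_def ugraph_connected_def by auto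
  obtain t where "t \<in> T" using T(4) by auto
  then have "{t} \<in> C" using singleton by (auto simp: C_def)
  moreover have "finite C"
    by (rule finite_subset[of _ "Pow T"]) (use T(1) in \<open>auto simp: C_def\<close>)
  ultimately have "\<exists>S\<in>C. \<forall>S'\<in>C. S \<subseteq> S' \<longrightarrow> S = S'"
    by (intro finite_has_maximal) auto
  then obtain S where SC: "S \<in> C" and max: "\<And>S'. S' \<in> C \<Longrightarrow> S \<subseteq> S' \<Longrightarrow> S = S'"
    by metis
  then have S: "S \<subseteq> T" "S \<noteq> {}" "?conn S" "P S" by (auto simp: C_def)
  have "S = T"
  proof (rule ccontr)
    assume "S \<noteq> T"
    then obtain a b where ab: "a \<in> S" "b \<in> T" "b \<notin> S" using S by auto
    have "?E\<^sup>*\<^sup>* a b" using T(5) ab S by auto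
    then have "b \<notin> S \<longrightarrow> (\<exists>y\<in>S. \<exists>x. x \<notin> S \<and> ?E y x)" using ab(1)
      by (induction rule: rtranclp_induct) blast+
    then obtain y x where xy: "y \<in> S" "x \<notin> S" "?E y x" using ab(3) by blast
    have xT: "x \<in> T" using xy(3) by (auto simp: hasse_edge_def poset_covered_by_def)
    have conn: "?conn (insert x S)"
    proof -
      let ?R = "\<lambda>a b. ?E a b \<and> a \<in> insert x S \<and> b \<in> insert x S"
      have 1: "?R\<^sup>*\<^sup>* a b" if "a \<in> S" "b \<in> S" for a b
      proof -
        have "(\<lambda>a b. ?E a b \<and> a \<in> S \<and> b \<in> S)\<^sup>*\<^sup>* a b" using S that by blast
        then show ?thesis by (rule rtranclp_mono[THEN predicate2D, rotated]) auto
      qed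
      have 2: "?R y x" "?R x y" using xy by (auto simp: hasse_edge_def)
      have 3: "?R\<^sup>*\<^sup>* a x" "?R\<^sup>*\<^sup>* x a" if "a \<in> S" for a
      proof -
        show "?R\<^sup>*\<^sup>* a x" by (rule rtranclp.rtrancl_into_rtrancl[where r = ?R, OF 1[OF that xy(1)] 2(1)])
        show "?R\<^sup>*\<^sup>* x a" by (rule converse_rtranclp_into_rtranclp[where r = ?R, OF 2(2) 1[OF xy(1) that]])
      qed
      show ?thesis using 1 3 by auto
    qed
    have "P (insert x S)"
    proof (cases "poset_covered_by T r y x")
      case True
      then have "leaf_above r S y x" using S T xy
        by (intro leaf_above_if_covered_by[where T=T]) auto
      then show ?thesis using above S xy xT by auto
    next
      case False
      then have "poset_covered_by T (r\<inverse>) y x"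
        using xy(3) unfolding hasse_edge_def poset_covered_by_def poset_less_def by auto
      moreover have "partial_order_on T (r\<inverse>)" using T(2) by simp
      ultimately have "leaf_above (r\<inverse>) S y x" using S T xy
        by (intro leaf_above_if_covered_by[where T=T]) (auto simp: hasse_edge_converse)
      then show ?thesis using below S xy xT by auto
    qed
    then have "insert x S \<in> C" using conn S xT by (simp add: C_def)
    then show False using max[of "insert x S"] xy(2) by auto
  qed
  then show ?thesis using S by simp
qed

text \<open>The labels will serve as positions in blocks of consecutive members of a chain:
  bijectivity makes them distinct, monotonicity puts comparable elements in the right order. A
  maximal element takes the top label.\<close>

lemma linear_extension:
  assumes "finite T" "partial_order_on T r"
  shows "\<exists>l :: 'a \<Rightarrow> nat. bij_betw l T {..<card T} \<and> (\<forall>x\<in>T. \<forall>y\<in>T. (x, y) \<in> r \<longrightarrow> x \<noteq> y \<longrightarrow> l x < l y)"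
  using assms
proof (induction "card T" arbitrary: T r)
  case 0
  then show ?case by (auto simp: bij_betw_def)
next
  case (Suc m)
  note po = partial_order_on_facts[OF Suc.prems(2)]
  have "T \<noteq> {}" using Suc.hyps(2) by auto
  have "\<exists>t\<in>T. \<forall>x\<in>T. (t, x) \<in> r \<longrightarrow> x = t"
  proof -
      have "asymp_on T (poset_less r)" using po by (auto simp: asymp_on_def poset_less_def dest: antisymD)
      moreover have "transp_on T (poset_less r)" using po
        by (auto simp: transp_on_def poset_less_def dest: antisymD) (meson transD)
      ultimately show ?thesis
        using Finite_Set.bex_max_element[of T "poset_less r"] Suc.prems(1) \<open>T \<noteq> {}\<close>
        by (auto simp: poset_less_def)
  qed
  then obtain t where t: "t \<in> T" "\<And>x. x \<in> T \<Longrightarrow> (t, x) \<in> r \<Longrightarrow> x = t" by blast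
  let ?T = "T - {t}"
  have c: "m = card ?T" using Suc.hyps(2) t by auto
  have "partial_order_on ?T (r \<inter> ?T \<times> ?T)"
    using po unfolding partial_order_on_def preorder_on_def refl_on_def
    by (auto simp: antisym_def intro!: transI dest: transD)
  from Suc.hyps(1)[OF c _ this] obtain l :: "'a \<Rightarrow> nat" where
    l: "bij_betw l ?T {..<m}" "\<And>x y. x \<in> ?T \<Longrightarrow> y \<in> ?T \<Longrightarrow> (x, y) \<in> r \<Longrightarrow> x \<noteq> y \<Longrightarrow> l x < l y"
    using Suc.prems c by auto
  let ?l = "l(t := m)"
  have "bij_betw ?l (insert t ?T) (insert m {..<m})"
    using l(1) by (auto simp: bij_betw_def inj_on_def)
  then have "bij_betw ?l T {..<card T}"
    by (metis Suc.hyps(2) insert_Diff lessThan_Suc t(1))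
  moreover have "?l x < ?l y" if "x \<in> T" "y \<in> T" "(x, y) \<in> r" "x \<noteq> y" for x y
    using that t l(2)[of x y] bij_betwE[OF l(1)] by auto
  ultimately show ?case by blast
qed

section \<open>Counting chains\<close>

text \<open>A full chain of subsets is encoded by the order in which the elements are added, so that
  counting chains becomes counting permutations.\<close>

definition chain_sets :: "'a set set \<Rightarrow> 'a list \<Rightarrow> 'a set list" where
  "chain_sets F xs = filter (\<lambda>A. A \<in> F) (map (\<lambda>j. set (take j xs)) [0..<Suc (length xs)])"

lemma sorted_wrt_chain_sets:
  assumes "distinct xs"
  shows "sorted_wrt (\<subset>) (chain_sets F xs)"
proof -
  have "set (take i xs) \<subset> set (take j xs)" if "i < j" "j \<le> length xs" for i j
  proof -
    have "set (take i xs) \<subseteq> set (take j xs)" using that by (simp add: set_take_subset_set_take)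
    moreover have "card (set (take i xs)) \<noteq> card (set (take j xs))"
      using assms that by (simp add: distinct_card)
    ultimately show ?thesis by auto
  qed
  then have "sorted_wrt (\<subset>) (map (\<lambda>j. set (take j xs)) [0..<Suc (length xs)])"
    by (auto simp: sorted_wrt_map sorted_wrt_iff_nth_less simp del: upt_Suc)
  then show ?thesis unfolding chain_sets_def by (rule sorted_wrt_filter)
qed

lemma distinct_chain_sets:
  assumes "distinct xs"
  shows "distinct (chain_sets F xs)"
  using sorted_wrt_chain_sets[OF assms, of F]
  by (auto simp: distinct_conv_nth sorted_wrt_iff_nth_less) (metis nat_neq_iff psubset_eq)

text \<open>The prefixes of \<open>xs\<close> have distinct sizes, so only the one of length
  \<open>card A\<close> can be \<open>A\<close>.\<close>

lemma in_set_chain_sets_iff: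
  assumes "distinct xs"
  shows "A \<in> set (chain_sets F xs) \<longleftrightarrow> A \<in> F \<and> set (take (card A) xs) = A"
proof
  assume "A \<in> set (chain_sets F xs)"
  then obtain j where j: "A \<in> F" "j \<le> length xs" "A = set (take j xs)"
    unfolding chain_sets_def by (auto simp del: upt_Suc)
  then have "card A = j" using assms by (simp add: distinct_card)
  then show "A \<in> F \<and> set (take (card A) xs) = A" using j by simp
next
  assume A: "A \<in> F \<and> set (take (card A) xs) = A"
  then have "card A \<le> length xs"
    by (metis List.finite_set card_length card_mono order.trans set_take_subset)
  then show "A \<in> set (chain_sets F xs)"
    unfolding chain_sets_def using A by (auto simp del: upt_Suc intro!: image_eqI[of _ _ "card A"])
qed

lemma take_drop_in_permutations:
  assumes "xs \<in> permutations_of_set U" "set (take m xs) = A"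
  shows "take m xs \<in> permutations_of_set A" "drop m xs \<in> permutations_of_set (U - A)"
proof -
  have d: "distinct xs" "set xs = U" using assms(1) by (auto simp: permutations_of_set_def)
  show "take m xs \<in> permutations_of_set A"
    using d assms(2) by (intro permutations_of_setI) auto
  have "distinct (take m xs @ drop m xs)" using d by simp
  then have "set (take m xs) \<inter> set (drop m xs) = {}" by (simp only: distinct_append)
  moreover have "set (take m xs) \<union> set (drop m xs) = U"
    using d(2) by (metis append_take_drop_id set_append)
  ultimately have "set (drop m xs) = U - A" using assms(2) by auto
  then show "drop m xs \<in> permutations_of_set (U - A)"
    using d by (intro permutations_of_setI) auto
qed

lemma append_in_permutations:
  assumes "us \<in> permutations_of_set A" "vs \<in> permutations_of_set (U - A)" "A \<subseteq> U" "finite U"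
  shows "us @ vs \<in> permutations_of_set U" "take (card A) (us @ vs) = us" "drop (card A) (us @ vs) = vs"
proof -
  have "length us = card A"
    using assms finite_subset by (metis length_finite_permutations_of_set)
  then show "take (card A) (us @ vs) = us" "drop (card A) (us @ vs) = vs" by simp_all
  show "us @ vs \<in> permutations_of_set U"
    using assms by (auto simp: permutations_of_set_def)
qed

text \<open>A chain through \<open>A\<close> consists of an ordering of \<open>A\<close> and one of
  its complement. The predicate \<open>R\<close> carries along conditions on the two halves.\<close>

lemma bij_betw_permutations_split:
  assumes "finite U" "A \<subseteq> U"
  shows "bij_betw (\<lambda>xs. (take (card A) xs, drop (card A) xs))
     {xs \<in> permutations_of_set U. set (take (card A) xs) = A \<and> R (take (card A) xs) (drop (card A) xs)}
     {(us, vs). us \<in> permutations_of_set A \<and> vs \<in> permutations_of_set (U - A) \<and> R us vs}"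
proof (rule bij_betw_byWitness[where f' = "\<lambda>(us, vs). us @ vs"], goal_cases)
  case 1
  show ?case by simp
next
  case 2
  show ?case using append_in_permutations(2,3)[OF _ _ assms(2,1)] by simp
next
  case 3
  show ?case
  proof (rule image_subsetI)
    fix xs assume "xs \<in> {xs \<in> permutations_of_set U.
      set (take (card A) xs) = A \<and> R (take (card A) xs) (drop (card A) xs)}"
    then show "(take (card A) xs, drop (card A) xs)
      \<in> {(us, vs). us \<in> permutations_of_set A \<and> vs \<in> permutations_of_set (U - A) \<and> R us vs}"
      using take_drop_in_permutations[of xs U "card A" A] by simp
  qed
next
  case 4
  show ?case
  proof (rule image_subsetI)
    fix p assume "p \<in> {(us, vs). us \<in> permutations_of_set A \<and> vs \<in> permutations_of_set (U - A) \<and> R us vs}"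
    then obtain us vs where p: "p = (us, vs)" and uv: "us \<in> permutations_of_set A"
      "vs \<in> permutations_of_set (U - A)" "R us vs" by auto
    have "set us = A" using uv(1) by (simp add: permutations_of_set_def)
    then show "(case p of (us, vs) \<Rightarrow> us @ vs) \<in> {xs \<in> permutations_of_set U.
      set (take (card A) xs) = A \<and> R (take (card A) xs) (drop (card A) xs)}"
      using append_in_permutations[OF uv(1,2) assms(2,1)] uv(3) p by simp
  qed
qed

lemma card_permutations_with_prefix_set:
  assumes "finite U" "A \<subseteq> U"
  shows "card {xs \<in> permutations_of_set U. set (take (card A) xs) = A}
         = fact (card A) * fact (card U - card A)"
proof -
  have fA: "finite A" using assms finite_subset by blast
  have "{(us, vs). us \<in> permutations_of_set A \<and> vs \<in> permutations_of_set (U - A) \<and> True}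
    = permutations_of_set A \<times> permutations_of_set (U - A)" by auto
  then show ?thesis
    using bij_betw_same_card[OF bij_betw_permutations_split[OF assms, of "\<lambda>_ _. True"]] assms fA
    by (simp add: card_cartesian_product card_Diff_subset)
qed

section \<open>Chains that meet forbidden elements\<close>

text \<open>Deleting the entry \<open>d\<close> leaves an ordering of the rest, from which the list
  is recovered by reinsertion at position \<open>j\<close>.\<close>

lemma card_permutations_nth_eq_le:
  assumes "finite M"
  shows "card {vs \<in> permutations_of_set M. j < length vs \<and> vs ! j = d} \<le> fact (card M - 1)"
proof (cases "d \<in> M")
  case True
  have "{vs \<in> permutations_of_set M. j < length vs \<and> vs ! j = d}
    \<subseteq> (\<lambda>us. take j us @ d # drop j us) ` permutations_of_set (M - {d})"
  proof safe
    fix vs assume vs: "vs \<in> permutations_of_set M" "j < length vs" "d = vs ! j"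
    have d: "distinct vs" "set vs = M" using vs by (auto simp: permutations_of_set_def)
    have eq: "vs = take j vs @ d # drop (Suc j) vs" using vs by (simp add: id_take_nth_drop)
    then have "distinct (take j vs @ d # drop (Suc j) vs)" using d by metis
    moreover have "set (take j vs @ d # drop (Suc j) vs) = M" using d eq by metis
    ultimately have "take j vs @ drop (Suc j) vs \<in> permutations_of_set (M - {d})"
      by (intro permutations_of_setI) auto
    moreover have "vs = take j (take j vs @ drop (Suc j) vs) @ d # drop j (take j vs @ drop (Suc j) vs)"
      using eq vs by simp
    ultimately show "vs \<in> (\<lambda>us. take j us @ vs ! j # drop j us) ` permutations_of_set (M - {vs ! j})"
      using vs(3) by blast
  qed
  then have "card {vs \<in> permutations_of_set M. j < length vs \<and> vs ! j = d}
     \<le> card (permutations_of_set (M - {d}))"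
    by (meson finite_permutations_of_set surj_card_le)
  then show ?thesis using assms True by (simp add: card_Diff_singleton)
next
  case False
  then have "{vs \<in> permutations_of_set M. j < length vs \<and> vs ! j = d} = {}"
    by (auto simp: permutations_of_set_def)
  then show ?thesis by (simp only: card.empty)
qed

text \<open>Union bound over the first \<open>h\<close> positions and the elements of
  \<open>D\<close>.\<close>

lemma card_permutations_take_meets_le:
  assumes "finite M" "finite D"
  shows "card {vs \<in> permutations_of_set M. set (take h vs) \<inter> D \<noteq> {}} \<le> h * card D * fact (card M - 1)"
proof -
  have "{vs \<in> permutations_of_set M. set (take h vs) \<inter> D \<noteq> {}}
    \<subseteq> (\<Union>(j, d)\<in>{..<h} \<times> D. {vs \<in> permutations_of_set M. j < length vs \<and> vs ! j = d})"
    by (fastforce simp: in_set_conv_nth)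
  then have "card {vs \<in> permutations_of_set M. set (take h vs) \<inter> D \<noteq> {}}
    \<le> card (\<Union>(j, d)\<in>{..<h} \<times> D. {vs \<in> permutations_of_set M. j < length vs \<and> vs ! j = d})"
    using assms by (intro card_mono) auto
  also have "\<dots> \<le> (\<Sum>(j, d)\<in>{..<h} \<times> D. card {vs \<in> permutations_of_set M. j < length vs \<and> vs ! j = d})"
    using card_UN_le[of "{..<h} \<times> D" "\<lambda>(j, d). {vs \<in> permutations_of_set M. j < length vs \<and> vs ! j = d}"] assms
    by (simp add: case_prod_unfold)
  also have "\<dots> \<le> (\<Sum>(j, d)\<in>{..<h} \<times> D. fact (card M - 1))"
    by (intro sum_mono) (use card_permutations_nth_eq_le[OF assms(1)] in auto)
  finally show ?thesis by (simp add: case_prod_unfold card_cartesian_product)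
qed

text \<open>A random chain from \<open>A\<close> is bad for an already embedded set \<open>f z\<close> if it meets
  a witness \<open>e z\<close> of non-inclusion within \<open>h\<close> steps, or if its first step stays inside a small
  difference \<open>D z\<close>.\<close>

definition bad_list :: "nat \<Rightarrow> 'b set \<Rightarrow> ('b \<Rightarrow> 'a) \<Rightarrow> ('b \<Rightarrow> 'a set) \<Rightarrow> 'a list \<Rightarrow> bool" where
  "bad_list h Z e D vs \<longleftrightarrow>
     (\<exists>z\<in>Z. e z \<in> set (take h vs) \<or> card (D z) \<le> h \<and> set (take 1 vs) \<inter> D z \<noteq> {})"

text \<open>Each \<open>z\<close> costs at most \<open>h\<close> for the witness \<open>e z\<close>
  among the first \<open>h\<close> entries, and at most \<open>h\<close> for a small
  \<open>D z\<close> at the first entry; hence the factor \<open>2 * h\<close>.\<close>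

lemma card_bad_list_le:
  assumes "finite M" "finite Z" "\<And>z. z \<in> Z \<Longrightarrow> finite (D z)"
  shows "card {vs \<in> permutations_of_set M. bad_list h Z e D vs} \<le> card Z * (2 * h) * fact (card M - 1)"
proof -
  let ?B1 = "\<lambda>z. {vs \<in> permutations_of_set M. set (take h vs) \<inter> {e z} \<noteq> {}}"
  let ?B2 = "\<lambda>z. {vs \<in> permutations_of_set M. card (D z) \<le> h \<and> set (take 1 vs) \<inter> D z \<noteq> {}}"
  have "{vs \<in> permutations_of_set M. bad_list h Z e D vs} = (\<Union>z\<in>Z. ?B1 z \<union> ?B2 z)"
    unfolding bad_list_def by auto
  then have "card {vs \<in> permutations_of_set M. bad_list h Z e D vs} \<le> (\<Sum>z\<in>Z. card (?B1 z \<union> ?B2 z))"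
    using card_UN_le[OF assms(2), of "\<lambda>z. ?B1 z \<union> ?B2 z"] by simp
  also have "\<dots> \<le> (\<Sum>z\<in>Z. 2 * h * fact (card M - 1))"
  proof (rule sum_mono)
    fix z assume z: "z \<in> Z"
    have 1: "card (?B1 z) \<le> h * fact (card M - 1)"
      using card_permutations_take_meets_le[OF assms(1), of "{e z}" h] by simp
    have 2: "card (?B2 z) \<le> h * fact (card M - 1)"
    proof (cases "card (D z) \<le> h")
      case True
      then have "card (?B2 z) \<le> card (D z) * fact (card M - 1)"
        using card_permutations_take_meets_le[OF assms(1) assms(3)[OF z], of 1] by simp
      also have "\<dots> \<le> h * fact (card M - 1)" using True by simp
      finally show ?thesis .
    qed simp
    have "card (?B1 z \<union> ?B2 z) \<le> card (?B1 z) + card (?B2 z)" by (rule card_Un_le)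
    with 1 2 show "card (?B1 z \<union> ?B2 z) \<le> 2 * h * fact (card M - 1)" by simp
  qed
  finally show ?thesis by simp
qed

text \<open>Only the ordering of the complement of \<open>A\<close> is constrained; the ordering of
  \<open>A\<close> itself is free and contributes \<open>fact (card A)\<close>.\<close>

lemma card_bad_above_le:
  assumes "finite U" "A \<subseteq> U" "finite Z" "\<And>z. z \<in> Z \<Longrightarrow> finite (D z)"
  shows "card {xs \<in> permutations_of_set U. set (take (card A) xs) = A \<and> bad_list h Z e D (drop (card A) xs)}
         \<le> fact (card A) * (card Z * (2 * h) * fact (card U - card A - 1))"
proof -
  have fA: "finite A" using assms finite_subset by blast
  have "card {xs \<in> permutations_of_set U. set (take (card A) xs) = A \<and> bad_list h Z e D (drop (card A) xs)}
    \<le> card (permutations_of_set A \<times> {vs \<in> permutations_of_set (U - A). bad_list h Z e D vs})"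
    unfolding bij_betw_same_card[OF bij_betw_permutations_split[OF assms(1,2), of "\<lambda>us vs. bad_list h Z e D vs"]]
    by (rule card_mono) auto
  also have "\<dots> \<le> fact (card A) * (card Z * (2 * h) * fact (card (U - A) - 1))"
    using card_bad_list_le[OF finite_Diff[OF assms(1)] assms(3,4), where h=h and e=e] fA
    by (simp add: card_cartesian_product)
  finally show ?thesis using assms fA by (simp add: card_Diff_subset)
qed

text \<open>Going down from \<open>A\<close>, the elements leave in the reverse of the order in
  which the chain added them, hence \<open>rev\<close>. Reversal permutes the orderings of
  \<open>A\<close>, so the earlier count applies.\<close>

lemma card_bad_below_le:
  assumes "finite U" "A \<subseteq> U" "finite Z" "\<And>z. z \<in> Z \<Longrightarrow> finite (D z)"
  shows "card {xs \<in> permutations_of_set U. set (take (card A) xs) = A \<and> bad_list h Z e D (rev (take (card A) xs))}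
         \<le> card Z * (2 * h) * fact (card A - 1) * fact (card U - card A)"
proof -
  have fA: "finite A" using assms finite_subset by blast
  let ?B = "{us \<in> permutations_of_set A. bad_list h Z e D (rev us)}"
  have "?B \<subseteq> rev ` {us \<in> permutations_of_set A. bad_list h Z e D us}"
  proof
    fix us assume us: "us \<in> ?B"
    then have "rev us \<in> {us \<in> permutations_of_set A. bad_list h Z e D us}"
      by (auto simp: permutations_of_set_def)
    then show "us \<in> rev ` {us \<in> permutations_of_set A. bad_list h Z e D us}"
      by (metis image_eqI rev_rev_ident)
  qed
  then have B: "card ?B \<le> card Z * (2 * h) * fact (card A - 1)"
  proof -
    have "card ?B \<le> card {us \<in> permutations_of_set A. bad_list h Z e D us}"
      by (rule surj_card_le) (simp, fact)
    also have "\<dots> \<le> card Z * (2 * h) * fact (card A - 1)"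
      by (rule card_bad_list_le[OF fA assms(3,4)])
    finally show ?thesis .
  qed
  have "card {xs \<in> permutations_of_set U. set (take (card A) xs) = A \<and> bad_list h Z e D (rev (take (card A) xs))}
    \<le> card (?B \<times> permutations_of_set (U - A))"
    unfolding bij_betw_same_card[OF bij_betw_permutations_split[OF assms(1,2), of "\<lambda>us vs. bad_list h Z e D (rev us)"]]
    by (rule card_mono) auto
  also have "\<dots> \<le> card Z * (2 * h) * fact (card A - 1) * fact (card U - card A)"
    using B assms fA by (simp add: card_cartesian_product card_Diff_subset)
  finally show ?thesis .
qed

section \<open>Double counting and pruning\<close>

text \<open>Double counting of incidences between full chains and members of \<open>F\<close>. The
  right-hand side is \<open>fact (card U)\<close> times the Lubell mass of \<open>F\<close>.\<close>

lemma sum_length_chain_sets: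
  assumes "finite U" "F \<subseteq> Pow U"
  shows "(\<Sum>xs\<in>permutations_of_set U. length (chain_sets F xs))
         = (\<Sum>A\<in>F. fact (card A) * fact (card U - card A))"
proof -
  have fF: "finite F" using assms by (meson finite_Pow_iff finite_subset)
  have "(\<Sum>xs\<in>permutations_of_set U. length (chain_sets F xs))
    = (\<Sum>xs\<in>permutations_of_set U. \<Sum>A\<in>F. if set (take (card A) xs) = A then 1 else 0)"
  proof (rule sum.cong[OF refl])
    fix xs assume "xs \<in> permutations_of_set U"
    then have d: "distinct xs" by (simp add: permutations_of_set_def)
    have "length (chain_sets F xs) = card (set (chain_sets F xs))"
      using distinct_chain_sets[OF d] by (simp add: distinct_card)
    also have "set (chain_sets F xs) = {A \<in> F. set (take (card A) xs) = A}"
      using in_set_chain_sets_iff[OF d] by blast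
    also have "card \<dots> = (\<Sum>A\<in>F. if set (take (card A) xs) = A then 1 else 0)"
      using fF by (simp add: sum.If_cases Int_def)
    finally show "length (chain_sets F xs) = (\<Sum>A\<in>F. if set (take (card A) xs) = A then 1 else 0)" .
  qed
  also have "\<dots> = (\<Sum>A\<in>F. \<Sum>xs\<in>permutations_of_set U. if set (take (card A) xs) = A then 1 else 0)"
    by (rule sum.swap)
  also have "\<dots> = (\<Sum>A\<in>F. card {xs \<in> permutations_of_set U. set (take (card A) xs) = A})"
    by (simp add: sum.If_cases Int_def)
  also have "\<dots> = (\<Sum>A\<in>F. fact (card A) * fact (card U - card A))"
    using assms by (intro sum.cong refl card_permutations_with_prefix_set) auto
  finally show ?thesis .
qed

text \<open>As long as some \<open>v\<close> in use has fewer than \<open>w v\<close> incidences,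
  delete \<open>v\<close> together with every element of \<open>Q\<close> incident to it. Each
  deletion costs \<open>Q\<close> less than it takes from the total weight, so the strict inequality
  persists and keeps \<open>Q\<close> nonempty.\<close>

lemma prune_incidences:
  fixes w :: "'v \<Rightarrow> real"
  assumes "finite V" "finite Q" "\<And>v. v \<in> V \<Longrightarrow> 0 \<le> w v" "\<And>q. q \<in> Q \<Longrightarrow> inc q \<subseteq> V"
    "(\<Sum>v\<in>V. w v) < real (card Q)"
  shows "\<exists>Q'\<subseteq>Q. Q' \<noteq> {} \<and> (\<forall>q\<in>Q'. \<forall>v\<in>inc q. w v \<le> real (card {q'\<in>Q'. v \<in> inc q'}))"
  using assms
proof (induction V arbitrary: Q rule: finite_psubset_induct)
  case (psubset V)
  show ?case
  proof (cases "\<forall>q\<in>Q. \<forall>v\<in>inc q. w v \<le> real (card {q'\<in>Q. v \<in> inc q'})")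
    case True
    have "0 \<le> (\<Sum>v\<in>V. w v)" using psubset.prems(2) by (intro sum_nonneg) auto
    then have "Q \<noteq> {}" using psubset.prems(4) by auto
    then show ?thesis using True by blast
  next
    case False
    then obtain q v where qv: "q \<in> Q" "v \<in> inc q" "real (card {q'\<in>Q. v \<in> inc q'}) < w v"
      by (auto simp: not_le)
    let ?Q = "{q'\<in>Q. v \<notin> inc q'}"
    have vV: "v \<in> V" using qv psubset.prems(3) by auto
    have "card Q = card ?Q + card {q'\<in>Q. v \<in> inc q'}"
      using psubset.prems(1) by (subst card_Un_disjoint[symmetric]) (auto intro: arg_cong[of _ _ card])
    moreover have "(\<Sum>v\<in>V. w v) = w v + (\<Sum>v\<in>V - {v}. w v)"
      using psubset.hyps vV by (simp add: sum.remove)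
    ultimately have "(\<Sum>v\<in>V - {v}. w v) < real (card ?Q)" using psubset.prems(4) qv(3) by simp
    then have "\<exists>Q'\<subseteq>?Q. Q' \<noteq> {} \<and> (\<forall>q\<in>Q'. \<forall>v\<in>inc q. w v \<le> real (card {q'\<in>Q'. v \<in> inc q'}))"
      using psubset.prems(1,2) psubset.prems(3) vV
      by (intro psubset.IH) auto
    then show ?thesis by blast
  qed
qed

section \<open>Color coding and embedding\<close>

text \<open>Average over all maps from \<open>K\<close> to the \<open>k\<close> positions: for every
  \<open>q\<close> the values at its \<open>k\<close> distinct colors are prescribed and the others
  are free, so a proportion \<open>1 / k ^ k\<close> of the maps suits \<open>q\<close>.\<close>

lemma color_coding:
  fixes col :: "'q \<Rightarrow> nat \<Rightarrow> 'c"
  assumes "finite Q" "finite K" "0 < k"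
    and inj: "\<And>q. q \<in> Q \<Longrightarrow> inj_on (col q) {..<k}"
    and K: "\<And>q. q \<in> Q \<Longrightarrow> col q ` {..<k} \<subseteq> K"
  shows "\<exists>\<rho>. card Q \<le> k ^ k * card {q \<in> Q. \<forall>p<k. \<rho> (col q p) = p}"
proof (rule ccontr)
  assume "\<not> ?thesis"
  then have less: "k ^ k * card {q \<in> Q. \<forall>p<k. \<rho> (col q p) = p} < card Q" for \<rho>
    by (simp add: not_le)
  define R where "R = K \<rightarrow>\<^sub>E {..<k}"
  have R: "finite R" "card R = k ^ card K" "R \<noteq> {}"
    using assms(2,3) by (auto simp: R_def card_PiE PiE_eq_empty_iff intro: finite_PiE)
  have count: "k ^ k * card {\<rho> \<in> R. \<forall>p<k. \<rho> (col q p) = p} = k ^ card K" if q: "q \<in> Q" for q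
  proof -
    let ?I = "col q ` {..<k}"
    \<comment> \<open>Admissible values of \<open>\<rho>\<close> at a color: forced on the colors of
      \<open>q\<close>, arbitrary elsewhere.\<close>
    let ?B = "\<lambda>a. if a \<in> ?I then {the_inv_into {..<k} (col q) a} else {..<k}"
    have inv: "the_inv_into {..<k} (col q) (col q p) = p" if "p < k" for p
      using the_inv_into_f_f[OF inj[OF q]] that by simp
    have "{\<rho> \<in> R. \<forall>p<k. \<rho> (col q p) = p} = Pi\<^sub>E K ?B"
    proof (intro Set.set_eqI iffI)
      fix \<rho> assume "\<rho> \<in> {\<rho> \<in> R. \<forall>p<k. \<rho> (col q p) = p}"
      then show "\<rho> \<in> Pi\<^sub>E K ?B" using inv by (auto simp: R_def PiE_iff)
    next
      fix \<rho> assume \<rho>: "\<rho> \<in> Pi\<^sub>E K ?B"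
      have "\<rho> (col q p) = p" if "p < k" for p
      proof -
        have "col q p \<in> K" "col q p \<in> ?I" using K[OF q] that by auto
        then show ?thesis using PiE_mem[OF \<rho>, of "col q p"] inv[OF that] by simp
      qed
      moreover have "\<rho> a < k" if "a \<in> K" for a
        using PiE_mem[OF \<rho> that] inv by (auto split: if_splits)
      ultimately show "\<rho> \<in> {\<rho> \<in> R. \<forall>p<k. \<rho> (col q p) = p}"
        using \<rho> by (auto simp: R_def PiE_iff)
    qed
    then have "card {\<rho> \<in> R. \<forall>p<k. \<rho> (col q p) = p} = (\<Prod>a\<in>K. card (?B a))"
      using assms(2) by (simp add: card_PiE)
    also have "\<dots> = (\<Prod>a\<in>K. if a \<in> ?I then 1 else k)" by (intro prod.cong) auto
    also have "\<dots> = k ^ card (K - ?I)"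
      using assms(2) by (simp add: prod.If_cases Diff_eq)
    also have "card (K - ?I) = card K - k"
      using K[OF q] card_image[OF inj[OF q]] by (simp add: card_Diff_subset)
    finally have c: "card {\<rho> \<in> R. \<forall>p<k. \<rho> (col q p) = p} = k ^ (card K - k)" .
    have "k \<le> card K" using card_mono[OF assms(2) K[OF q]] card_image[OF inj[OF q]] by simp
    then show ?thesis unfolding c by (simp flip: power_add)
  qed
  \<comment> \<open>If every map failed, summing over the maps and exchanging the sums would
    contradict the exact count for each \<open>q\<close>.\<close>
  have "k ^ k * (\<Sum>\<rho>\<in>R. card {q \<in> Q. \<forall>p<k. \<rho> (col q p) = p}) < (\<Sum>\<rho>\<in>R. card Q)"
    unfolding sum_distrib_left using R less by (intro sum_strict_mono) auto
  also have "\<dots> = (\<Sum>q\<in>Q. k ^ k * card {\<rho> \<in> R. \<forall>p<k. \<rho> (col q p) = p})"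
    using count R by simp
  also have "\<dots> = k ^ k * (\<Sum>q\<in>Q. \<Sum>\<rho>\<in>R. if \<forall>p<k. \<rho> (col q p) = p then 1 else 0)"
    using R by (simp add: sum_distrib_left sum.If_cases Int_def)
  also have "(\<Sum>q\<in>Q. \<Sum>\<rho>\<in>R. if \<forall>p<k. \<rho> (col q p) = p then 1 else 0)
    = (\<Sum>\<rho>\<in>R. \<Sum>q\<in>Q. if \<forall>p<k. \<rho> (col q p) = p then (1::nat) else 0)"
    by (rule sum.swap)
  also have "\<dots> = (\<Sum>\<rho>\<in>R. card {q \<in> Q. \<forall>p<k. \<rho> (col q p) = p})"
    using assms(1) by (simp add: sum.If_cases Int_def)
  finally show False by simp
qed

text \<open>An element \<open>(xs, i)\<close> of \<open>Q\<close> stands for the full chain of prefix sets of \<open>xs\<close>, marked at the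
  \<open>k\<close> consecutive members of \<open>F\<close> on it that start with the \<open>i\<close>-th one. Taking consecutive members
  makes the mark on a given chain unique once the set at position \<open>p\<close> is known.\<close>

locale dense_marks =
  fixes U :: "'b set" and F :: "'b set set" and k :: nat and Q :: "('b list \<times> nat) set"
    and \<eta> :: real and lo h M :: nat
  assumes finite_U: "finite U" and F_Pow: "F \<subseteq> Pow U"
    and marks: "(xs, i) \<in> Q \<Longrightarrow> xs \<in> permutations_of_set U \<and> i + k \<le> length (chain_sets F xs)"
    and finite_Q: "finite Q" and Q_nonempty: "Q \<noteq> {}"
    and dense: "(xs, i) \<in> Q \<Longrightarrow> p < k \<Longrightarrow> A = chain_sets F xs ! (i + p) \<Longrightarrow>
      \<eta> * (fact (card A) * fact (card U - card A))
        \<le> real (card {q \<in> Q. chain_sets F (fst q) ! (snd q + p) = A})"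
    and size: "A \<in> F \<Longrightarrow> lo \<le> card A \<and> card A \<le> lo + h"
    and M: "0 < M" "M \<le> lo" "M + lo + h \<le> card U" "real (2 * k * h) < \<eta> * real M"
begin

definition member :: "'b list \<times> nat \<Rightarrow> nat \<Rightarrow> 'b set" where
  "member q p = chain_sets F (fst q) ! (snd q + p)"

lemma finite_member: "A \<in> F \<Longrightarrow> finite A"
  using finite_U F_Pow finite_subset by blast

lemma member_psubset:
  assumes "q \<in> Q" "p < p'" "p' < k"
  shows "member q p \<subset> member q p'"
proof -
  obtain xs i where q: "q = (xs, i)" by fastforce
  have "distinct xs" using marks assms(1) q by (auto simp: permutations_of_set_def)
  from sorted_wrt_chain_sets[OF this, of F] show ?thesis
    using assms marks[of xs i] by (auto simp: member_def q sorted_wrt_iff_nth_less)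
qed

lemma member_in_F:
  assumes "q \<in> Q" "p < k"
  shows "member q p \<in> F" "set (take (card (member q p)) (fst q)) = member q p"
proof -
  obtain xs i where q: "q = (xs, i)" by fastforce
  have d: "distinct xs" using marks assms(1) q by (auto simp: permutations_of_set_def)
  have "member q p \<in> set (chain_sets F xs)"
    using assms marks[of xs i] by (auto simp: member_def q)
  then show "member q p \<in> F" "set (take (card (member q p)) (fst q)) = member q p"
    using in_set_chain_sets_iff[OF d] q by auto
qed

text \<open>A mark with \<open>A\<close> at position \<open>p\<close> is determined by its chain, on
  which \<open>A\<close> occurs only once. So \<open>dense\<close> provides at least a proportion
  \<open>\<eta>\<close> of all chains through \<open>A\<close>, and fewer bad chains cannot exhaust
  them.\<close>

lemma exists_mark_avoiding:
  assumes q: "q \<in> Q" "p < k" "A = member q p"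
    and less: "real (card {xs \<in> permutations_of_set U. set (take (card A) xs) = A \<and> bad xs})
      < \<eta> * (fact (card A) * fact (card U - card A))"
  shows "\<exists>q'\<in>Q. member q' p = A \<and> \<not> bad (fst q')"
proof (rule ccontr)
  assume none: "\<not> ?thesis"
  let ?QA = "{q \<in> Q. chain_sets F (fst q) ! (snd q + p) = A}"
  have "inj_on fst ?QA"
  proof (rule inj_onI)
    fix s t assume st: "s \<in> ?QA" "t \<in> ?QA" "fst s = fst t"
    obtain xs i j where s: "s = (xs, i)" "t = (xs, j)" using st(3) by (metis prod.collapse)
    have "distinct (chain_sets F xs)"
      using marks[of xs i] st(1) s by (intro distinct_chain_sets) (auto simp: permutations_of_set_def)
    moreover have "i + p < length (chain_sets F xs)" "j + p < length (chain_sets F xs)"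
      using marks[of xs i] marks[of xs j] st s q(2) by auto
    moreover have "chain_sets F xs ! (i + p) = chain_sets F xs ! (j + p)" using st s by simp
    ultimately show "s = t" using s by (simp add: nth_eq_iff_index_eq)
  qed
  moreover have "fst ` ?QA \<subseteq> {xs \<in> permutations_of_set U. set (take (card A) xs) = A \<and> bad xs}"
  proof (rule image_subsetI)
    fix s assume s: "s \<in> ?QA"
    then have "member s p = A" by (simp add: member_def)
    moreover have "fst s \<in> permutations_of_set U" using marks[of "fst s" "snd s"] s by simp
    ultimately show "fst s \<in> {xs \<in> permutations_of_set U. set (take (card A) xs) = A \<and> bad xs}"
      using none member_in_F(2)[of s p] s q(2) by auto
  qed
  ultimately have "card ?QA \<le> card {xs \<in> permutations_of_set U. set (take (card A) xs) = A \<and> bad xs}"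
    by (intro card_inj_on_le[of fst]) auto
  moreover have "\<eta> * (fact (card A) * fact (card U - card A)) \<le> real (card ?QA)"
    using dense[of "fst q" "snd q" p A] q by (simp add: member_def)
  ultimately show False using less by linarith
qed

text \<open>Here \<open>m\<close> will be the number of elements outside or inside \<open>A\<close>,
  which is at least \<open>M\<close> in the layers in use. The bad proportion is at most
  \<open>2 * g * h / m\<close>, hence below \<open>\<eta>\<close>.\<close>

lemma bad_fraction:
  assumes "M \<le> m" "g \<le> k"
  shows "real (g * (2 * h) * fact (m - 1)) < \<eta> * fact m"
proof -
  have m: "0 < m" "real M \<le> real m" using M(1) assms(1) by auto
  have "0 \<le> real (2 * k * h)" by simp
  then have "0 < \<eta> * real M" using M(4) by linarith
  then have \<eta>: "0 < \<eta>" using M(1) by (simp add: zero_less_mult_iff)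
  have "real (g * (2 * h)) \<le> real (2 * k * h)"
    using assms(2) by (simp add: mult_mono del: of_nat_mult)
  also have "\<dots> < \<eta> * real M" by (rule M(4))
  also have "\<dots> \<le> \<eta> * real m" using m \<eta> by simp
  finally have "real (g * (2 * h)) * fact (m - 1) < \<eta> * real m * fact (m - 1)" by simp
  then show ?thesis using m(1) by (simp add: fact_reduce[of m] mult.assoc)
qed

text \<open>Take a mark on a good chain through \<open>A\<close>, with \<open>B\<close> at position
  \<open>p'\<close>. From \<open>A\<close> to \<open>B\<close> at most \<open>h\<close> elements are
  added, none of them a witness \<open>e g\<close>, so \<open>g\<close> is not inside
  \<open>B\<close>. Were \<open>B\<close> inside \<open>g\<close>, then \<open>g - A\<close> would
  have at most \<open>h\<close> elements and contain the first element added, which is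
  excluded.\<close>

lemma extend_above:
  assumes q: "q \<in> Q" "p < p'" "p' < k" "A = member q p"
    and G: "finite G" "card G \<le> k" "G \<subseteq> F" "\<And>g. g \<in> G \<Longrightarrow> \<not> g \<subseteq> A"
  shows "\<exists>q'\<in>Q. A \<subset> member q' p' \<and> (\<forall>g\<in>G. \<not> g \<subseteq> member q' p' \<and> \<not> member q' p' \<subseteq> g)"
proof -
  have pk: "p < k" using q by simp
  have AF: "A \<in> F" "A \<subseteq> U" "finite A" using member_in_F[OF q(1) pk] q(4) F_Pow finite_member by auto
  have "\<forall>g\<in>G. \<exists>e. e \<in> g - A" using G(4) by auto
  then obtain e where "\<forall>g\<in>G. e g \<in> g - A" using bchoice[of G "\<lambda>g a. a \<in> g - A"] by auto
  then have e: "\<And>g. g \<in> G \<Longrightarrow> e g \<in> g - A" by auto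
  let ?bad = "\<lambda>xs. bad_list h G e (\<lambda>g. g - A) (drop (card A) xs)"
  have "card {xs \<in> permutations_of_set U. set (take (card A) xs) = A \<and> ?bad xs}
      \<le> fact (card A) * (card G * (2 * h) * fact (card U - card A - 1))"
    using G finite_member by (intro card_bad_above_le finite_U AF) auto
  then have "real (card {xs \<in> permutations_of_set U. set (take (card A) xs) = A \<and> ?bad xs})
      \<le> real (fact (card A) * (card G * (2 * h) * fact (card U - card A - 1)))"
    by (simp only: of_nat_le_iff)
  also have "\<dots> = fact (card A) * real (card G * (2 * h) * fact (card U - card A - 1))"
    by (simp only: of_nat_mult of_nat_fact)
  also have "\<dots> < fact (card A) * (\<eta> * fact (card U - card A))"
    using bad_fraction[of "card U - card A" "card G"] size[OF AF(1)] M(3) G(2)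
    by (intro mult_strict_left_mono) auto
  also have "\<dots> = \<eta> * (fact (card A) * fact (card U - card A))" by (rule mult.left_commute)
  finally obtain q' where q': "q' \<in> Q" "member q' p = A" "\<not> ?bad (fst q')"
    using exists_mark_avoiding[OF q(1) pk q(4), of ?bad] by blast
  define ys B where "ys = fst q'" and "B = member q' p'"
  let ?a = "card A" and ?b = "card B"
  have AB: "A \<subset> B" using member_psubset[OF q'(1) q(2,3)] q'(2) B_def by simp
  have BF: "B \<in> F" "set (take ?b ys) = B" using member_in_F[OF q'(1) q(3)] B_def ys_def by auto
  have A: "set (take ?a ys) = A" using member_in_F(2)[OF q'(1) pk] q'(2) ys_def by simp
  have d: "distinct ys" "set ys = U" "length ys = card U"
    using marks[of "fst q'" "snd q'"] q'(1) finite_U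
    by (auto simp: ys_def permutations_of_set_def distinct_card)
  have ab: "?a < ?b" "?b \<le> ?a + h"
    using psubset_card_mono[OF finite_member[OF BF(1)] AB] size[OF BF(1)] size[OF AF(1)] by auto
  have bU: "?b \<le> card U" using BF(1) F_Pow finite_U by (auto intro: card_mono)
  have "take ?b ys = take ?a ys @ take (?b - ?a) (drop ?a ys)"
    using ab(1) take_add[of ?a "?b - ?a" ys] by simp
  then have B: "B = A \<union> set (take (?b - ?a) (drop ?a ys))" using A BF(2) by (metis set_append)
  have step: "set (take (?b - ?a) (drop ?a ys)) \<subseteq> set (take h (drop ?a ys))"
    using ab by (intro set_take_subset_set_take) auto
  \<comment> \<open>\<open>ys ! ?a\<close> is the first element that the chain adds to
    \<open>A\<close>; it will refute \<open>B \<subseteq> g\<close>.\<close>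
  have "ys ! ?a \<in> B"
    using BF(2) ab(1) bU d(3) by (metis in_set_conv_nth length_take min.absorb2 nth_take)
  have disj: "set (take ?a ys) \<inter> set (drop ?a ys) = {}"
    using d(1) by (metis append_take_drop_id distinct_append)
  have hd: "take 1 (drop ?a ys) = [ys ! ?a]"
    using ab(1) bU d(3) by (simp add: take_Suc_conv_app_nth)
  have "ys ! ?a \<in> set (drop ?a ys)"
    using hd by (metis in_set_takeD list.set_intros(1))
  then have "ys ! ?a \<notin> A" using disj A by auto
  have "\<not> g \<subseteq> B \<and> \<not> B \<subseteq> g" if g: "g \<in> G" for g
  proof
    have nb: "e g \<notin> set (take h (drop ?a ys))"
      "card (g - A) \<le> h \<Longrightarrow> set (take 1 (drop ?a ys)) \<inter> (g - A) = {}"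
      using q'(3) g by (auto simp: bad_list_def ys_def)
    show "\<not> g \<subseteq> B" using nb(1) e[OF g] B step by auto
    show "\<not> B \<subseteq> g"
    proof
      assume Bg: "B \<subseteq> g"
      have gF: "g \<in> F" using g G(3) by auto
      have "card (g - A) = card g - ?a" using AB Bg AF(3) by (intro card_Diff_subset) auto
      then have "card (g - A) \<le> h" using size[OF gF] size[OF AF(1)] by auto
      then show False using nb(2) hd Bg \<open>ys ! ?a \<in> B\<close> \<open>ys ! ?a \<notin> A\<close> by auto
    qed
  qed
  then show ?thesis using q'(1) AB B_def by blast
qed

text \<open>Mirror image of the upward step, with witnesses in \<open>A - g\<close>. As none of them
  is removed on the way down to \<open>B\<close>, the set \<open>B\<close> is not inside
  \<open>g\<close>; if \<open>g\<close> were inside \<open>B\<close>, the first element removed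
  would lie in the small difference \<open>A - g\<close>.\<close>

lemma extend_below:
  assumes q: "q \<in> Q" "p' < p" "p < k" "A = member q p"
    and G: "finite G" "card G \<le> k" "G \<subseteq> F" "\<And>g. g \<in> G \<Longrightarrow> \<not> A \<subseteq> g"
  shows "\<exists>q'\<in>Q. member q' p' \<subset> A \<and> (\<forall>g\<in>G. \<not> g \<subseteq> member q' p' \<and> \<not> member q' p' \<subseteq> g)"
proof -
  have pk: "p' < k" using q by simp
  have AF: "A \<in> F" "A \<subseteq> U" "finite A" using member_in_F[OF q(1) q(3)] q(4) F_Pow finite_member by auto
  have "\<forall>g\<in>G. \<exists>e. e \<in> A - g" using G(4) by auto
  then obtain e where "\<forall>g\<in>G. e g \<in> A - g" using bchoice[of G "\<lambda>g a. a \<in> A - g"] by auto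
  then have e: "\<And>g. g \<in> G \<Longrightarrow> e g \<in> A - g" by auto
  let ?bad = "\<lambda>xs. bad_list h G e (\<lambda>g. A - g) (rev (take (card A) xs))"
  have "card {xs \<in> permutations_of_set U. set (take (card A) xs) = A \<and> ?bad xs}
      \<le> card G * (2 * h) * fact (card A - 1) * fact (card U - card A)"
    using G AF by (intro card_bad_below_le finite_U AF) auto
  then have "real (card {xs \<in> permutations_of_set U. set (take (card A) xs) = A \<and> ?bad xs})
      \<le> real (card G * (2 * h) * fact (card A - 1) * fact (card U - card A))"
    by (simp only: of_nat_le_iff)
  also have "\<dots> = real (card G * (2 * h) * fact (card A - 1)) * fact (card U - card A)"
    by (simp only: of_nat_mult of_nat_fact)
  also have "\<dots> < \<eta> * fact (card A) * fact (card U - card A)"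
    using bad_fraction[of "card A" "card G"] size[OF AF(1)] M(2) G(2)
    by (intro mult_strict_right_mono) auto
  also have "\<dots> = \<eta> * (fact (card A) * fact (card U - card A))" by (rule mult.assoc)
  finally obtain q' where q': "q' \<in> Q" "member q' p = A" "\<not> ?bad (fst q')"
    using exists_mark_avoiding[OF q(1) q(3) q(4), of ?bad] by blast
  define ys B where "ys = fst q'" and "B = member q' p'"
  let ?a = "card A" and ?b = "card B"
  have BA: "B \<subset> A" using member_psubset[OF q'(1) q(2,3)] q'(2) B_def by simp
  have BF: "B \<in> F" "set (take ?b ys) = B" using member_in_F[OF q'(1) pk] B_def ys_def by auto
  have A: "set (take ?a ys) = A" using member_in_F(2)[OF q'(1) q(3)] q'(2) ys_def by simp
  have d: "distinct ys" "set ys = U" "length ys = card U"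
    using marks[of "fst q'" "snd q'"] q'(1) finite_U
    by (auto simp: ys_def permutations_of_set_def distinct_card)
  have ab: "?b < ?a" "?a \<le> ?b + h"
    using psubset_card_mono[OF AF(3) BA] size[OF BF(1)] size[OF AF(1)] by auto
  have aU: "?a \<le> card U" using AF finite_U by (auto intro: card_mono)
  \<comment> \<open>The elements by which \<open>A\<close> exceeds \<open>B\<close>; read backwards,
    they are the first ones to be removed.\<close>
  define ws where "ws = take (?a - ?b) (drop ?b ys)"
  have split: "take ?a ys = take ?b ys @ ws"
    using ab(1) take_add[of ?b "?a - ?b" ys] by (simp add: ws_def)
  then have AB: "A = B \<union> set ws" using A BF(2) by (metis set_append)
  have disj: "B \<inter> set ws = {}"
    using split d(1) BF(2) by (metis distinct_append distinct_take)
  have lw: "length ws = ?a - ?b" using aU d(3) by (simp add: ws_def)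
  have take_rev: "take j (rev (take ?a ys)) = take j (rev ws)" if "j \<le> ?a - ?b" for j
    using that lw by (simp add: split)
  have "set ws = set (take (?a - ?b) (rev (take ?a ys)))" using take_rev[of "?a - ?b"] lw by simp
  also have "\<dots> \<subseteq> set (take h (rev (take ?a ys)))"
    using ab by (intro set_take_subset_set_take) auto
  finally have step: "set ws \<subseteq> set (take h (rev (take ?a ys)))" .
  obtain x where x: "take 1 (rev (take ?a ys)) = [x]" "x \<in> set ws"
  proof -
    have "rev ws \<noteq> []" using lw ab(1) by auto
    then obtain x zs where "rev ws = x # zs" by (cases "rev ws") auto
    moreover from this have "x \<in> set ws" by (metis list.set_intros(1) set_rev)
    ultimately show ?thesis using that take_rev[of 1] ab(1) by auto
  qed
  have "\<not> g \<subseteq> B \<and> \<not> B \<subseteq> g" if g: "g \<in> G" for g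
  proof
    have nb: "e g \<notin> set (take h (rev (take ?a ys)))"
      "card (A - g) \<le> h \<Longrightarrow> set (take 1 (rev (take ?a ys))) \<inter> (A - g) = {}"
      using q'(3) g by (auto simp: bad_list_def ys_def)
    show "\<not> B \<subseteq> g" using nb(1) e[OF g] AB step by auto
    show "\<not> g \<subseteq> B"
    proof
      assume gB: "g \<subseteq> B"
      have gF: "g \<in> F" using g G(3) by auto
      have "card (A - g) = ?a - card g" using BA gB finite_member[OF gF] by (intro card_Diff_subset) auto
      then have "card (A - g) \<le> h" using size[OF gF] size[OF AF(1)] by auto
      then show False using nb(2) x gB AB disj by auto
    qed
  qed
  then show ?thesis using q'(1) BA B_def by blast
qed

text \<open>Every image comes with a mark carrying it at its own position, which is what attaching
  the next leaf starts from. Monotone labels put a leaf above \<open>y\<close> at a later position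
  than \<open>y\<close> and a leaf below \<open>y\<close> at an earlier one.\<close>

lemma embed_tree_poset:
  assumes T: "tree_poset T r" "card T \<le> k"
    and l: "\<And>x. x \<in> T \<Longrightarrow> l x < k" "\<And>x y. x \<in> T \<Longrightarrow> y \<in> T \<Longrightarrow> (x, y) \<in> r \<Longrightarrow> x \<noteq> y \<Longrightarrow> l x < l y"
  shows "\<exists>f. (\<forall>x\<in>T. \<exists>q\<in>Q. f x = member q (l x)) \<and> (\<forall>x\<in>T. \<forall>y\<in>T. (x, y) \<in> r \<longleftrightarrow> f x \<subseteq> f y)"
  using T(1)
proof (induction rule: tree_poset_leaf_induct)
  case (singleton x)
  have "(x, x) \<in> r" using T(1) singleton partial_order_on_facts(2) unfolding tree_poset_def by metis
  moreover obtain q where "q \<in> Q" using Q_nonempty by auto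
  ultimately show ?case by (intro exI[of _ "\<lambda>_. member q (l x)"]) auto
next
  case (insert_above S x y)
  have fT: "finite T" using T(1) by (simp add: tree_poset_def)
  have xx: "(x, x) \<in> r" using T(1) insert_above.hyps(2) partial_order_on_facts(2) unfolding tree_poset_def by (metis DiffD1)
  from insert_above.IH obtain f where f0: "\<forall>z\<in>S. \<exists>q\<in>Q. f z = member q (l z)"
    "\<forall>u\<in>S. \<forall>v\<in>S. (u, v) \<in> r \<longleftrightarrow> f u \<subseteq> f v"
    by (elim exE conjE)
  have f: "\<And>z. z \<in> S \<Longrightarrow> \<exists>q\<in>Q. f z = member q (l z)"
    "\<And>u v. u \<in> S \<Longrightarrow> v \<in> S \<Longrightarrow> (u, v) \<in> r \<longleftrightarrow> f u \<subseteq> f v"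
    using f0 by simp_all
  have yx: "(y, x) \<in> r" and leaf: "\<And>w. w \<in> S \<Longrightarrow> (w, x) \<in> r \<longleftrightarrow> (w, y) \<in> r" "\<And>w. w \<in> S \<Longrightarrow> (x, w) \<notin> r"
    using insert_above.hyps by (auto simp: leaf_above_def)
  have fS: "f ` S \<subseteq> F" using f(1) member_in_F(1) l(1) insert_above.hyps(1) by fastforce
  obtain q where q: "q \<in> Q" "f y = member q (l y)" using f(1) insert_above.hyps(3) by blast
  \<comment> \<open>Images inside \<open>f y\<close> lie below the new set anyway, as
    \<open>leaf_above\<close> demands; all other images must become incomparable to it.\<close>
  let ?G = "{g \<in> f ` S. \<not> g \<subseteq> f y}"
  have finS: "finite S" using fT insert_above.hyps(1) finite_subset by blast
  have "card ?G \<le> card (f ` S)" using finS by (intro card_mono) auto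
  also have "\<dots> \<le> card S" using finS by (rule card_image_le)
  also have "\<dots> \<le> k" using card_mono[OF fT insert_above.hyps(1)] T(2) by simp
  finally have cG: "card ?G \<le> k" .
  have lyx: "l y < l x" "l x < k" using l insert_above.hyps yx by auto
  have "\<exists>q'\<in>Q. f y \<subset> member q' (l x) \<and> (\<forall>g\<in>?G. \<not> g \<subseteq> member q' (l x) \<and> \<not> member q' (l x) \<subseteq> g)"
    by (rule extend_above[OF q(1) lyx q(2)]) (use finS fS cG in auto)
  then obtain q' where q': "q' \<in> Q" "f y \<subset> member q' (l x)"
    "\<forall>g\<in>?G. \<not> g \<subseteq> member q' (l x) \<and> \<not> member q' (l x) \<subseteq> g"
    by (elim bexE conjE)
  define B where "B = member q' (l x)"
  have up: "(z, x) \<in> r \<longleftrightarrow> f z \<subseteq> B" "\<not> B \<subseteq> f z" if z: "z \<in> S" for z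
  proof -
    have *: "f z \<subseteq> f y \<longleftrightarrow> (z, x) \<in> r" using f(2) z insert_above.hyps(3) leaf(1) by simp
    show "(z, x) \<in> r \<longleftrightarrow> f z \<subseteq> B" "\<not> B \<subseteq> f z"
      using * q'(2) bspec[OF q'(3), of "f z"] z unfolding B_def by blast+
  qed
  have "x \<notin> S" using insert_above.hyps(2) by simp
  then show ?case
    using f up q'(1) leaf(2) xx
    by (intro exI[of _ "f(x := B)"]) (auto simp: B_def)
next
  case (insert_below S x y)
  have fT: "finite T" using T(1) by (simp add: tree_poset_def)
  have xx: "(x, x) \<in> r" using T(1) insert_below.hyps(2) partial_order_on_facts(2) unfolding tree_poset_def by (metis DiffD1)
  from insert_below.IH obtain f where f0: "\<forall>z\<in>S. \<exists>q\<in>Q. f z = member q (l z)"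
    "\<forall>u\<in>S. \<forall>v\<in>S. (u, v) \<in> r \<longleftrightarrow> f u \<subseteq> f v"
    by (elim exE conjE)
  have f: "\<And>z. z \<in> S \<Longrightarrow> \<exists>q\<in>Q. f z = member q (l z)"
    "\<And>u v. u \<in> S \<Longrightarrow> v \<in> S \<Longrightarrow> (u, v) \<in> r \<longleftrightarrow> f u \<subseteq> f v"
    using f0 by simp_all
  have yx: "(x, y) \<in> r" and leaf: "\<And>w. w \<in> S \<Longrightarrow> (x, w) \<in> r \<longleftrightarrow> (y, w) \<in> r" "\<And>w. w \<in> S \<Longrightarrow> (w, x) \<notin> r"
    using insert_below.hyps by (auto simp: leaf_above_def)
  have fS: "f ` S \<subseteq> F" using f(1) member_in_F(1) l(1) insert_below.hyps(1) by fastforce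
  obtain q where q: "q \<in> Q" "f y = member q (l y)" using f(1) insert_below.hyps(3) by blast
  \<comment> \<open>Dually, the images containing \<open>f y\<close> contain the new set
    automatically.\<close>
  let ?G = "{g \<in> f ` S. \<not> f y \<subseteq> g}"
  have finS: "finite S" using fT insert_below.hyps(1) finite_subset by blast
  have "card ?G \<le> card (f ` S)" using finS by (intro card_mono) auto
  also have "\<dots> \<le> card S" using finS by (rule card_image_le)
  also have "\<dots> \<le> k" using card_mono[OF fT insert_below.hyps(1)] T(2) by simp
  finally have cG: "card ?G \<le> k" .
  have lyx: "l x < l y" "l y < k" using l insert_below.hyps yx by auto
  have "\<exists>q'\<in>Q. member q' (l x) \<subset> f y \<and> (\<forall>g\<in>?G. \<not> g \<subseteq> member q' (l x) \<and> \<not> member q' (l x) \<subseteq> g)"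
    by (rule extend_below[OF q(1) lyx q(2)]) (use finS fS cG in auto)
  then obtain q' where q': "q' \<in> Q" "member q' (l x) \<subset> f y"
    "\<forall>g\<in>?G. \<not> g \<subseteq> member q' (l x) \<and> \<not> member q' (l x) \<subseteq> g"
    by (elim bexE conjE)
  define B where "B = member q' (l x)"
  have down: "(x, z) \<in> r \<longleftrightarrow> B \<subseteq> f z" "\<not> f z \<subseteq> B" if z: "z \<in> S" for z
  proof -
    have *: "f y \<subseteq> f z \<longleftrightarrow> (x, z) \<in> r" using f(2) z insert_below.hyps(3) leaf(1) by simp
    show "(x, z) \<in> r \<longleftrightarrow> B \<subseteq> f z" "\<not> f z \<subseteq> B"
      using * q'(2) bspec[OF q'(3), of "f z"] z unfolding B_def by blast+
  qed
  have "x \<notin> S" using insert_below.hyps(2) by simp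
  then show ?case
    using f down q'(1) leaf(2) xx
    by (intro exI[of _ "f(x := B)"]) (auto simp: B_def)
qed

end

section \<open>From Lubell mass to a rainbow copy\<close>

text \<open>If the rest misses the target \<open>a\<close>, one further item overshoots it by at
  most \<open>b\<close>. This will trim a family to a Lubell mass that is also bounded from above,
  as the total pruning weight has to be.\<close>

lemma exists_subset_sum_between:
  fixes w :: "'a \<Rightarrow> real"
  assumes "finite F" "\<And>x. x \<in> F \<Longrightarrow> 0 \<le> w x" "\<And>x. x \<in> F \<Longrightarrow> w x \<le> b" "0 \<le> a" "0 \<le> b" "a \<le> sum w F"
  shows "\<exists>G\<subseteq>F. a \<le> sum w G \<and> sum w G \<le> a + b"
  using assms
proof (induction F rule: finite_induct)
  case empty
  then show ?case by auto
next
  case (insert x F)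
  show ?case
  proof (cases "a \<le> sum w F")
    case True
    then show ?thesis using insert by (meson insertI2 subset_insertI2)
  next
    case False
    moreover have "w x \<le> b" using insert.prems by blast
    ultimately have "sum w (insert x F) \<le> a + b" using insert.hyps by simp
    then show ?thesis using insert.prems by blast
  qed
qed

text \<open>The value of \<open>\<eta>\<close> balances pruning against color coding:
  \<open>k\<close> positions and mass at most \<open>k + 1\<close> give a total weight of at most
  \<open>\<eta> * k * (k + 1)\<close> per chain, which is half of the
  \<open>\<epsilon> / k ^ k\<close> marks per chain that survive the coding.\<close>

lemma rainbow_copy_if_lubell_mass:
  fixes F :: "'b set set" and T :: "'a set"
  assumes U: "finite U" "F \<subseteq> Pow U" and T: "tree_poset T r" and c: "proper_family_coloring F c"
    and k: "k = card T"
    and \<epsilon>: "0 < \<epsilon>" "\<eta> = \<epsilon> / (2 * real k * real k ^ k * (real k + 1))"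
    and mass: "(real k - 1 + \<epsilon>) * fact (card U) \<le> (\<Sum>A\<in>F. fact (card A) * fact (card U - card A))"
      "(\<Sum>A\<in>F. fact (card A) * fact (card U - card A)) \<le> (real k + 1) * fact (card U)"
    and size: "\<And>A. A \<in> F \<Longrightarrow> lo \<le> card A \<and> card A \<le> lo + h"
    and M: "0 < M" "M \<le> lo" "M + lo + h \<le> card U" "real (2 * k * h) < \<eta> * real M"
  shows "has_rainbow_copy T r F c"
proof -
  have fT: "finite T" "partial_order_on T r" "T \<noteq> {}"
    using T by (auto simp: tree_poset_def ugraph_tree_def ugraph_connected_def)
  then have k0: "0 < k" using k by (simp add: card_gt_0_iff)
  have fF: "finite F" using U by (meson finite_Pow_iff finite_subset)
  let ?P = "permutations_of_set U"
  let ?N = "fact (card U) :: real"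
  let ?W = "\<lambda>A. fact (card A) * fact (card U - card A) :: real"
  define Q0 where "Q0 = (SIGMA xs:?P. {i. i + k \<le> length (chain_sets F xs)})"
  have finI: "finite {i. i + k \<le> length (chain_sets F xs)}" for xs
    by (rule finite_subset[of _ "{..length (chain_sets F xs)}"]) auto
  have finQ0: "finite Q0" unfolding Q0_def using finI by auto
  have cP: "real (card ?P) = ?N" using U(1) by simp
  have Q0: "\<epsilon> * ?N \<le> real (card Q0)"
  proof -
    \<comment> \<open>A chain with at least \<open>k\<close> members carries exactly this many
      blocks; with fewer members the left side is at most 0.\<close>
    have one: "real (length (chain_sets F xs)) - (real k - 1) \<le> real (card {i. i + k \<le> length (chain_sets F xs)})" for xs
    proof (cases "k \<le> length (chain_sets F xs)")
      case True
      then have "{i. i + k \<le> length (chain_sets F xs)} = {..length (chain_sets F xs) - k}" by auto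
      then show ?thesis using True by (simp add: of_nat_diff)
    next
      case False
      then show ?thesis by linarith
    qed
    have "(real k - 1 + \<epsilon>) * ?N \<le> real (\<Sum>A\<in>F. fact (card A) * fact (card U - card A))"
      using mass(1) by simp
    also have "\<dots> = (\<Sum>xs\<in>?P. real (length (chain_sets F xs)))"
      unfolding sum_length_chain_sets[OF U, symmetric] by simp
    finally have "\<epsilon> * ?N \<le> (\<Sum>xs\<in>?P. real (length (chain_sets F xs))) - (real k - 1) * ?N"
      by (simp add: algebra_simps)
    also have "\<dots> = (\<Sum>xs\<in>?P. real (length (chain_sets F xs)) - (real k - 1))"
      using cP by (simp add: sum_subtractf)
    also have "\<dots> \<le> (\<Sum>xs\<in>?P. real (card {i. i + k \<le> length (chain_sets F xs)}))"
      by (intro sum_mono one)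
    also have "\<dots> = real (card Q0)" unfolding Q0_def using finI by (simp add: card_SigmaI)
    finally show ?thesis .
  qed
  let ?mem = "\<lambda>q p. chain_sets F (fst q) ! (snd q + p)"
  have mem: "?mem q p \<in> F" if "q \<in> Q0" "p < k" for q p
  proof -
    have "?mem q p \<in> set (chain_sets F (fst q))" using that by (auto simp: Q0_def)
    then show ?thesis by (auto simp: chain_sets_def)
  qed
  have mono: "?mem q p \<subset> ?mem q p'" if "q \<in> Q0" "p < p'" "p' < k" for q p p'
  proof -
    have "distinct (fst q)" using that(1) by (auto simp: Q0_def permutations_of_set_def)
    then have "sorted_wrt (\<subset>) (chain_sets F (fst q))" by (rule sorted_wrt_chain_sets)
    moreover have "snd q + p < snd q + p'" "snd q + p' < length (chain_sets F (fst q))"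
      using that by (auto simp: Q0_def)
    ultimately show ?thesis by (rule sorted_wrt_nth_less)
  qed
  have "\<exists>\<rho>. card Q0 \<le> k ^ k * card {q \<in> Q0. \<forall>p<k. \<rho> (c (?mem q p)) = p}"
  proof (rule color_coding[OF finQ0 _ k0, where K = "c ` F"])
    show "finite (c ` F)" using fF by simp
    show "(\<lambda>p. c (?mem q p)) ` {..<k} \<subseteq> c ` F" if "q \<in> Q0" for q using mem that by auto
    \<comment> \<open>The members of a block form a chain, so properness separates their
      colors.\<close>
    show "inj_on (\<lambda>p. c (?mem q p)) {..<k}" if q: "q \<in> Q0" for q
    proof (rule linorder_inj_onI)
      fix x y assume "x < y" "x \<in> {..<k}" "y \<in> {..<k}"
      then show "c (?mem q x) \<noteq> c (?mem q y)"
        using c mono[OF q, of x y] mem[OF q] unfolding proper_family_coloring_def by auto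
    qed auto
  qed
  then obtain \<rho> where \<rho>: "card Q0 \<le> k ^ k * card {q \<in> Q0. \<forall>p<k. \<rho> (c (?mem q p)) = p}" by blast
  define Q1 where "Q1 = {q \<in> Q0. \<forall>p<k. \<rho> (c (?mem q p)) = p}"
  have finQ1: "finite Q1" using finQ0 by (simp add: Q1_def)
  have kk: "0 < real k ^ k" using k0 by simp
  have "\<epsilon> * ?N \<le> real (k ^ k * card Q1)" using Q0 \<rho> unfolding Q1_def by (meson of_nat_le_iff order_trans)
  then have Q1: "\<epsilon> * ?N / real k ^ k \<le> real (card Q1)" using kk by (simp add: field_simps)
  have \<eta>0: "0 < \<eta>" using \<epsilon> k0 by simp
  have "(\<Sum>v\<in>F \<times> {..<k}. \<eta> * ?W (fst v)) = (\<Sum>A\<in>F. \<Sum>p<k. \<eta> * ?W A)"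
    by (subst sum.cartesian_product) (simp only: case_prod_unfold)
  also have "\<dots> = \<eta> * real k * (\<Sum>A\<in>F. ?W A)"
    by (simp add: sum_distrib_left mult_ac)
  also have "\<dots> \<le> \<eta> * real k * ((real k + 1) * ?N)"
    using mass(2) \<eta>0 by (intro mult_left_mono) auto
  also have "\<dots> = \<epsilon> * ?N / real k ^ k / 2"
  proof -
    have "e / (2 * x * y * z) * x * (z * N) = e * N / y / 2" if "0 < x" "0 < z" for e x y z N :: real
      using that by simp
    then show ?thesis unfolding \<epsilon>(2) using k0 by (metis add_pos_pos of_nat_0_less_iff zero_less_one)
  qed
  also have "\<dots> < \<epsilon> * ?N / real k ^ k" 
  proof -
    have "x / 2 < x" if "0 < x" for x :: real using that by simp
    then show ?thesis using \<epsilon>(1) kk by (meson divide_pos_pos mult_pos_pos fact_gt_zero)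
  qed
  also note Q1
  finally have less: "(\<Sum>v\<in>F \<times> {..<k}. \<eta> * ?W (fst v)) < real (card Q1)" .
  \<comment> \<open>Pruning runs on pairs of a set and a position, because \<open>dense\<close> asks
    for many marks with \<open>A\<close> at a given position.\<close>
  let ?inc = "\<lambda>q. (\<lambda>p. (?mem q p, p)) ` {..<k}"
  have "\<exists>Q\<subseteq>Q1. Q \<noteq> {} \<and> (\<forall>q\<in>Q. \<forall>v\<in>?inc q. \<eta> * ?W (fst v) \<le> real (card {q'\<in>Q. v \<in> ?inc q'}))"
  proof (rule prune_incidences[where V = "F \<times> {..<k}" and w = "\<lambda>v. \<eta> * ?W (fst v)", OF _ finQ1 _ _ less])
    show "finite (F \<times> {..<k})" using fF by simp
    show "0 \<le> \<eta> * ?W (fst v)" for v using \<eta>0 by simp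
    show "?inc q \<subseteq> F \<times> {..<k}" if "q \<in> Q1" for q
      using mem[of q] that by (simp add: Q1_def image_subset_iff)
  qed
  then obtain Q where Q: "Q \<subseteq> Q1" "Q \<noteq> {}"
    "\<forall>q\<in>Q. \<forall>v\<in>?inc q. \<eta> * ?W (fst v) \<le> real (card {q'\<in>Q. v \<in> ?inc q'})" by (elim exE conjE)
  interpret dense_marks U F k Q \<eta> lo h M
  proof
    show "xs \<in> ?P \<and> i + k \<le> length (chain_sets F xs)" if "(xs, i) \<in> Q" for xs i
      using that Q(1) by (auto simp: Q1_def Q0_def)
    show "finite Q" using Q(1) finQ1 by (rule finite_subset)
    show "\<eta> * ?W A \<le> real (card {q \<in> Q. ?mem q p = A})"
      if "(xs, i) \<in> Q" "p < k" "A = chain_sets F xs ! (i + p)" for xs i p A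
    proof -
      have "(A, p) \<in> ?inc (xs, i)" using that by auto
      with that(1) have "\<eta> * ?W A \<le> real (card {q'\<in>Q. (A, p) \<in> ?inc q'})"
        using Q(3) by fastforce
      also have "{q'\<in>Q. (A, p) \<in> ?inc q'} = {q \<in> Q. ?mem q p = A}" using that(2) by auto
      finally show ?thesis .
    qed
  qed (use U size M Q(2) in auto)
  obtain l :: "'a \<Rightarrow> nat" where l: "bij_betw l T {..<k}"
    "\<And>x y. x \<in> T \<Longrightarrow> y \<in> T \<Longrightarrow> (x, y) \<in> r \<Longrightarrow> x \<noteq> y \<Longrightarrow> l x < l y"
    using linear_extension[OF fT(1,2)] k by auto
  have lk: "l x < k" if "x \<in> T" for x using bij_betwE[OF l(1)] that by auto
  have "\<exists>f. (\<forall>x\<in>T. \<exists>q\<in>Q. f x = member q (l x)) \<and> (\<forall>x\<in>T. \<forall>y\<in>T. (x, y) \<in> r \<longleftrightarrow> f x \<subseteq> f y)"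
    using k by (intro embed_tree_poset T lk l(2)) auto
  then obtain f where f: "\<forall>x\<in>T. \<exists>q\<in>Q. f x = member q (l x)"
    "\<forall>x\<in>T. \<forall>y\<in>T. (x, y) \<in> r \<longleftrightarrow> f x \<subseteq> f y" by (elim exE conjE)
  \<comment> \<open>In the surviving marks \<open>\<rho>\<close> sends the color at position
    \<open>p\<close> to \<open>p\<close>. So the color of \<open>f x\<close> determines
    \<open>l x\<close> and hence \<open>x\<close>, which gives both the injectivity of
    \<open>f\<close> and distinct colors.\<close>
  have \<rho>f: "\<rho> (c (f x)) = l x" "f x \<in> F" if x: "x \<in> T" for x
  proof -
    obtain q where q: "q \<in> Q" "f x = member q (l x)" using f(1) x by auto
    show "f x \<in> F" using member_in_F(1)[OF q(1) lk[OF x]] q(2) by simp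
    have "q \<in> Q1" using q(1) Q(1) by auto
    then show "\<rho> (c (f x)) = l x" using lk[OF x] q(2) by (simp add: Q1_def member_def)
  qed
  have inj: "x = y" if "x \<in> T" "y \<in> T" "c (f x) = c (f y)" for x y
    using \<rho>f(1)[OF that(1)] \<rho>f(1)[OF that(2)] that bij_betw_imp_inj_on[OF l(1)] by (metis inj_onD)
  have "bij_betw f T (f ` T)" using inj by (auto simp: bij_betw_def intro!: inj_onI)
  then have "poset_copy T r (f ` T)" unfolding poset_copy_def using f(2) by blast
  moreover have "inj_on c (f ` T)" using inj by (auto intro!: inj_onI)
  moreover have "f ` T \<subseteq> F" using \<rho>f(2) by auto
  ultimately show ?thesis unfolding has_rainbow_copy_def by blast
qed

section \<open>Asymptotics\<close>

lemma central_binomial_ge: "2 ^ n \<le> (n + 1) * (n choose (n div 2))"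
proof -
  have "2 ^ n = (\<Sum>i\<le>n. n choose i)" by (simp add: choose_row_sum)
  also have "\<dots> \<le> (\<Sum>i\<le>n. n choose (n div 2))" by (intro sum_mono binomial_maximum)
  finally show ?thesis by simp
qed

lemma card_subsets_by_card:
  fixes P :: "nat \<Rightarrow> bool"
  shows "card {A \<in> Pow {1..n}. P (card A)} = (\<Sum>i | i \<le> n \<and> P i. n choose i)"
proof -
  have "{A \<in> Pow {1..n}. P (card A)} = (\<Union>i\<in>{i. i \<le> n \<and> P i}. {A. A \<subseteq> {1..n} \<and> card A = i})"
    using card_mono[of "{1..n}"] by fastforce
  also have "card \<dots> = (\<Sum>i | i \<le> n \<and> P i. card {A. A \<subseteq> {1..n} \<and> card A = i})"
    by (rule card_UN_disjoint) auto
  also have "\<dots> = (\<Sum>i | i \<le> n \<and> P i. n choose i)" by (simp add: n_subsets)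
  finally show ?thesis .
qed

text \<open>Hoeffding's inequality for the size of a uniformly random subset, which is binomially
  distributed with success probability \<open>1/2\<close>.\<close>

lemma card_far_from_middle_le:
  assumes "0 < n" "0 \<le> \<delta>"
  shows "real (card {A \<in> Pow {1..n}. \<delta> * n \<le> \<bar>real (card A) - n / 2\<bar>}) \<le> 2 ^ n * (2 * exp (- 2 * \<delta>\<^sup>2 * n))"
proof -
  interpret binomial_distribution n "1/2" by unfold_locales simp
  let ?I = "{i. i \<le> n \<and> \<delta> * n \<le> \<bar>real i - n / 2\<bar>}"
  have "real (card {A \<in> Pow {1..n}. \<delta> * n \<le> \<bar>real (card A) - n / 2\<bar>}) / 2 ^ n
    = (\<Sum>i\<in>?I. real (n choose i) / 2 ^ n)"
    unfolding card_subsets_by_card[of n "\<lambda>a. \<delta> * n \<le> \<bar>real a - n / 2\<bar>"]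
    by (simp add: sum_divide_distrib)
  also have "\<dots> = (\<Sum>i\<in>?I. pmf (binomial_pmf n (1/2)) i)"
    by (intro sum.cong) (auto simp: power_add[symmetric] field_simps simp flip: power_add)
  also have "\<dots> = measure_pmf.prob (binomial_pmf n (1/2)) ?I"
    by (subst measure_measure_pmf_finite) auto
  also have "\<dots> \<le> measure_pmf.prob (binomial_pmf n (1/2)) {i. \<bar>real i - real n * (1/2)\<bar> \<ge> \<delta> * n}"
    by (intro measure_pmf.finite_measure_mono) auto
  also have "\<dots> \<le> 2 * exp (- 2 * (\<delta> * n)\<^sup>2 / n)"
    using assms by (intro prob_abs_ge) auto
  also have "- 2 * (\<delta> * n)\<^sup>2 / n = - 2 * \<delta>\<^sup>2 * n"
    using assms(1) by (simp add: power2_eq_square)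
  finally show ?thesis by (simp add: field_simps)
qed

text \<open>Exponential decay beats the factor \<open>n + 1\<close> lost when \<open>2 ^ n\<close>
  is replaced by the central binomial coefficient.\<close>

lemma far_from_middle_negligible:
  assumes "0 < \<delta>" "0 < \<epsilon>"
  shows "eventually (\<lambda>n. real (card {A \<in> Pow {1..n}. \<delta> * n \<le> \<bar>real (card A) - n / 2\<bar>})
           \<le> \<epsilon> * real (n choose (n div 2))) at_top"
proof -
  have "(\<lambda>n. (real n + 1) * (2 * exp (- 2 * \<delta>\<^sup>2 * real n))) \<longlonglongrightarrow> 0"
    using assms(1) by real_asymp
  then have "eventually (\<lambda>n. (real n + 1) * (2 * exp (- 2 * \<delta>\<^sup>2 * real n)) < \<epsilon>) at_top"
    using assms(2) by (rule order_tendstoD)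
  then show ?thesis using eventually_gt_at_top[of 0]
  proof eventually_elim
    case (elim n)
    have "real (2 ^ n) \<le> real ((n + 1) * (n choose (n div 2)))"
      using central_binomial_ge by (simp only: of_nat_le_iff)
    then have c: "2 ^ n \<le> (real n + 1) * real (n choose (n div 2))" by (simp add: algebra_simps)
    have "real (card {A \<in> Pow {1..n}. \<delta> * n \<le> \<bar>real (card A) - n / 2\<bar>})
      \<le> 2 ^ n * (2 * exp (- 2 * \<delta>\<^sup>2 * n))"
      using assms elim by (intro card_far_from_middle_le) auto
    also have "\<dots> \<le> (real n + 1) * real (n choose (n div 2)) * (2 * exp (- 2 * \<delta>\<^sup>2 * n))"
      using c by (rule mult_right_mono) simp
    also have "\<dots> = ((real n + 1) * (2 * exp (- 2 * \<delta>\<^sup>2 * n))) * real (n choose (n div 2))" by simp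
    also have "\<dots> \<le> \<epsilon> * real (n choose (n div 2))"
      using elim by (intro mult_right_mono) auto
    finally show ?case .
  qed
qed

text \<open>Turns cardinality into Lubell mass: every set contributes at least the reciprocal of the
  central binomial coefficient.\<close>

lemma fact_div_central_binomial_le:
  assumes "a \<le> n"
  shows "fact n \<le> real (n choose (n div 2)) * (fact a * fact (n - a))"
proof -
  have "fact n = real (n choose a) * (fact a * fact (n - a))"
    using assms by (simp add: binomial_fact)
  also have "\<dots> \<le> real (n choose (n div 2)) * (fact a * fact (n - a))"
    using binomial_maximum by (intro mult_right_mono) auto
  finally show ?thesis .
qed

text \<open>No single set contributes more than 1 to the Lubell mass, so trimming overshoots by at
  most \<open>fact n\<close>.\<close>

lemma fact_mult_fact_le:
  assumes "a \<le> n"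
  shows "fact a * fact (n - a) \<le> (fact n :: real)"
proof -
  have "1 \<le> n choose a" using assms by (simp add: Suc_leI)
  then have "1 * (fact a * fact (n - a)) \<le> real (n choose a) * (fact a * fact (n - a))"
    by (intro mult_right_mono) auto
  also have "\<dots> = fact n" using assms by (simp add: binomial_fact)
  finally show ?thesis by simp
qed

section \<open>The upper bound\<close>

text \<open>One half of \<open>\<epsilon>\<close> pays for the sets far from the middle; the other
  half is the excess of Lubell mass left to the sets near the middle, which are then trimmed to mass
  at most \<open>k + 1\<close>.\<close>

lemma family_upper_bound:
  assumes T: "tree_poset T r" and \<epsilon>: "0 < \<epsilon>" "\<epsilon> \<le> 1"
  shows "eventually (\<lambda>n. \<forall>F (c :: nat set \<Rightarrow> 'c). F \<subseteq> Pow {1..n} \<longrightarrow> proper_family_coloring F c \<longrightarrow>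
    \<not> has_rainbow_copy T r F c \<longrightarrow>
    real (card F) \<le> (real (card T) - 1 + \<epsilon>) * real (n choose (n div 2))) at_top"
proof -
  define k where "k = card T"
  have "finite T" "T \<noteq> {}"
    using T by (auto simp: tree_poset_def ugraph_tree_def ugraph_connected_def)
  then have k0: "1 \<le> k" using k_def by (simp add: Suc_leI card_gt_0_iff)
  define \<eta> where "\<eta> = (\<epsilon> / 2) / (2 * real k * real k ^ k * (real k + 1))"
  have \<eta>: "0 < \<eta>" using \<epsilon> k0 by (simp add: \<eta>_def)
  \<comment> \<open>With \<open>d\<close> close to \<open>\<delta> * n\<close> and \<open>m\<close>
    close to \<open>n / 2\<close>, the requirement will be
    \<open>(4 * k + \<eta>) * d < \<eta> * m\<close>. This choice makes the left side about
    \<open>\<eta> * n / 4\<close>, half of the right side.\<close>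
  define \<delta> where "\<delta> = \<eta> / (4 * (4 * real k + \<eta>))"
  have \<delta>: "0 < \<delta>" using \<eta> by (simp add: \<delta>_def add_nonneg_pos)
  \<comment> \<open>The slack \<open>\<eta> / 4 * n\<close> absorbs the rounding:
    \<open>4 * k + \<eta>\<close> from the ceiling in \<open>d\<close> and \<open>\<eta> / 2\<close>
    from the floor in \<open>m\<close>.\<close>
  have "eventually (\<lambda>n. 4 * real k + 3 / 2 * \<eta> < \<eta> / 4 * real n) at_top"
    using \<eta> by real_asymp
  moreover have "eventually (\<lambda>n. real (card {A \<in> Pow {1..n}. \<delta> * n \<le> \<bar>real (card A) - n / 2\<bar>})
           \<le> \<epsilon> / 2 * real (n choose (n div 2))) at_top"
    using \<delta> \<epsilon> by (intro far_from_middle_negligible) auto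
  ultimately show ?thesis
  proof eventually_elim
    case (elim n)
    let ?b = "real (n choose (n div 2))"
    let ?W = "\<lambda>A. fact (card A) * fact (n - card A) :: real"
    show ?case
    proof (intro allI impI, rule ccontr)
      fix F and c :: "nat set \<Rightarrow> 'c"
      assume F: "F \<subseteq> Pow {1..n}" "proper_family_coloring F c" "\<not> has_rainbow_copy T r F c"
        and "\<not> real (card F) \<le> (real (card T) - 1 + \<epsilon>) * ?b"
      then have large: "(real k - 1 + \<epsilon>) * ?b < real (card F)" by (simp add: k_def)
      have finF: "finite F" using F(1) by (rule finite_subset) simp
      have cn: "card A \<le> n" if "A \<in> F" for A
        using card_mono[of "{1..n}" A] F(1) that by auto
      define F1 where "F1 = {A \<in> F. \<not> \<delta> * n \<le> \<bar>real (card A) - n / 2\<bar>}"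
      have "card F \<le> card (F1 \<union> {A \<in> Pow {1..n}. \<delta> * n \<le> \<bar>real (card A) - n / 2\<bar>})"
        using F(1) finF by (intro card_mono) (auto simp: F1_def)
      also have "\<dots> \<le> card F1 + card {A \<in> Pow {1..n}. \<delta> * n \<le> \<bar>real (card A) - n / 2\<bar>}"
        by (rule card_Un_le)
      finally have "real (card F) \<le> real (card F1) + \<epsilon> / 2 * ?b" using elim(2) by linarith
      then have F1: "(real k - 1 + \<epsilon> / 2) * ?b \<le> real (card F1)" using large by (simp add: algebra_simps)
      have b0: "0 < ?b" by simp
      have "?b * ((real k - 1 + \<epsilon> / 2) * fact n) = (real k - 1 + \<epsilon> / 2) * ?b * fact n" by simp
      also have "\<dots> \<le> real (card F1) * fact n" using F1 by (rule mult_right_mono) simp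
      also have "\<dots> = (\<Sum>A\<in>F1. fact n)" by simp
      also have "\<dots> \<le> (\<Sum>A\<in>F1. ?b * ?W A)"
        using cn by (intro sum_mono fact_div_central_binomial_le) (auto simp: F1_def)
      also have "\<dots> = ?b * (\<Sum>A\<in>F1. ?W A)" by (simp only: sum_distrib_left)
      finally have mass: "(real k - 1 + \<epsilon> / 2) * fact n \<le> (\<Sum>A\<in>F1. ?W A)" using b0 by simp
      have "\<exists>G\<subseteq>F1. (real k - 1 + \<epsilon> / 2) * fact n \<le> (\<Sum>A\<in>G. ?W A) \<and>
        (\<Sum>A\<in>G. ?W A) \<le> (real k - 1 + \<epsilon> / 2) * fact n + fact n"
      proof (rule exists_subset_sum_between[OF _ _ _ _ _ mass])
        show "finite F1" using finF by (simp add: F1_def)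
        show "?W A \<le> fact n" if "A \<in> F1" for A
          using that cn by (intro fact_mult_fact_le) (auto simp: F1_def)
        show "0 \<le> (real k - 1 + \<epsilon> / 2) * fact n" using k0 \<epsilon> by simp
      qed auto
      then obtain G where G: "G \<subseteq> F1" "(real k - 1 + \<epsilon> / 2) * fact n \<le> (\<Sum>A\<in>G. ?W A)"
        "(\<Sum>A\<in>G. ?W A) \<le> (real k - 1 + \<epsilon> / 2) * fact n + fact n" by blast
      have GF: "G \<subseteq> F" using G(1) by (auto simp: F1_def)
      \<comment> \<open>The remaining sets have sizes from \<open>m - d\<close> to
        \<open>m + d\<close>, so \<open>lo = m - d\<close> and \<open>h = 2 * d\<close>; at least
        \<open>M = m - d\<close> elements are left inside and outside each of them.\<close>
      define m d where "m = n div 2" and "d = nat \<lceil>\<delta> * n\<rceil>"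
      have m: "real n / 2 - 1 / 2 \<le> real m" "real m \<le> real n / 2"
        unfolding m_def by linarith+
      have "0 \<le> \<delta> * n" using \<delta> by simp
      then have d: "\<delta> * n \<le> real d" "real d \<le> \<delta> * n + 1"
        unfolding d_def by linarith+
      have "(4 * real k + \<eta>) * real d \<le> (4 * real k + \<eta>) * (\<delta> * n + 1)"
        using d \<eta> by (intro mult_left_mono) auto
      also have "\<dots> = \<eta> / 4 * n + 4 * real k + \<eta>"
      proof -
        have "s * (\<eta> / (4 * s)) = \<eta> / 4" if "0 < s" for s :: real using that by simp
        from this[of "4 * real k + \<eta>"] have "(4 * real k + \<eta>) * \<delta> = \<eta> / 4"
          unfolding \<delta>_def using \<eta> by (meson add_nonneg_pos mult_nonneg_nonneg of_nat_0_le_iff zero_le_numeral)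
        then show ?thesis by (simp add: distrib_left flip: mult.assoc)
      qed
      also have "\<dots> < \<eta> * (real n / 2 - 1 / 2)" using elim(1) by (simp add: algebra_simps)
      also have "\<dots> \<le> \<eta> * real m" using m \<eta> by (intro mult_left_mono) auto
      finally have dm: "4 * real k * real d < \<eta> * (real m - real d)" by (simp add: algebra_simps)
      moreover have "0 \<le> 4 * real k * real d" by simp
      ultimately have "0 < \<eta> * (real m - real d)" by linarith
      then have "d < m" using \<eta> by (simp add: zero_less_mult_iff)
      have "has_rainbow_copy T r G c"
      proof (rule rainbow_copy_if_lubell_mass[where U = "{1..n}" and \<epsilon> = "\<epsilon> / 2" and \<eta> = \<eta>
            and k = k and lo = "m - d" and h = "2 * d" and M = "m - d"])
        show "G \<subseteq> Pow {1..n}" using GF F(1) by blast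
        show "proper_family_coloring G c" using F(2) GF unfolding proper_family_coloring_def by blast
        show "(real k - 1 + \<epsilon> / 2) * fact (card {1..n}) \<le> (\<Sum>A\<in>G. fact (card A) * fact (card {1..n} - card A))"
          using G(2) by simp
        have "(real k - 1 + \<epsilon> / 2) * fact n + fact n = (real k + \<epsilon> / 2) * fact n"
          by (simp add: algebra_simps)
        also have "\<dots> \<le> (real k + 1) * fact n" using \<epsilon> by (intro mult_right_mono) auto
        finally show "(\<Sum>A\<in>G. fact (card A) * fact (card {1..n} - card A)) \<le> (real k + 1) * fact (card {1..n})"
          using G(3) by simp
        show "m - d \<le> card A \<and> card A \<le> m - d + 2 * d" if "A \<in> G" for A
        proof -
          have "\<bar>real (card A) - n / 2\<bar> < \<delta> * n" using that G(1) by (auto simp: F1_def)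
          then have "real m - real d < real (card A)" "real (card A) < real m + 1 / 2 + real d"
            using m d by linarith+
          then show ?thesis using \<open>d < m\<close> by linarith
        qed
        show "m - d + (m - d) + 2 * d \<le> card {1..n}" using \<open>d < m\<close> by (simp add: m_def)
        show "real (2 * k * (2 * d)) < \<eta> * real (m - d)" using dm \<open>d < m\<close> by (simp add: of_nat_diff)
      qed (use T k_def \<epsilon> \<open>d < m\<close> in \<open>auto simp: \<eta>_def\<close>)
      then show False using F(3) GF unfolding has_rainbow_copy_def by blast
    qed
  qed
qed

section \<open>The extremal number and its lower bound\<close>

lemma finite_La_star_R_set:
  "finite {card \<F> | \<F> :: nat set set. \<F> \<subseteq> Pow {1..n} \<and>
       (\<exists>c :: nat set \<Rightarrow> nat. proper_family_coloring \<F> c \<and> \<not> has_rainbow_copy P r \<F> c)}"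
  by (rule finite_subset[of _ "card ` Pow (Pow {1..n})"]) auto

lemma La_star_R_attained:
  assumes "P \<noteq> {}"
  obtains F :: "nat set set" and c :: "nat set \<Rightarrow> nat" where "F \<subseteq> Pow {1..n}"
    "proper_family_coloring F c" "\<not> has_rainbow_copy P r F c" "La_star_R n P r = card F"
proof -
  let ?S = "{card \<F> | \<F> :: nat set set. \<F> \<subseteq> Pow {1..n} \<and>
       (\<exists>c :: nat set \<Rightarrow> nat. proper_family_coloring \<F> c \<and> \<not> has_rainbow_copy P r \<F> c)}"
  have "\<not> has_rainbow_copy P r {} c" for c :: "nat set \<Rightarrow> nat"
    using assms by (auto simp: has_rainbow_copy_def poset_copy_def bij_betw_def)
  then have "card ({} :: nat set set) \<in> ?S" by (force simp: proper_family_coloring_def)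
  then have "Max ?S \<in> ?S" using finite_La_star_R_set by (intro Max_in) auto
  then show ?thesis using that unfolding La_star_R_def by blast
qed

lemma La_star_R_ge:
  assumes "F \<subseteq> Pow {1..n}" "proper_family_coloring F (c :: nat set \<Rightarrow> nat)" "\<not> has_rainbow_copy P r F c"
  shows "card F \<le> La_star_R n P r"
  unfolding La_star_R_def by (rule Max_ge[OF finite_La_star_R_set]) (use assms in blast)

text \<open>The \<open>l\<close> layers from \<open>n div 2\<close> upwards, colored by size, use
  only \<open>l\<close> colors, too few for a rainbow copy of a poset with \<open>l + 1\<close>
  elements.\<close>

lemma La_star_R_ge_middle_layers:
  assumes "finite P" "card P = Suc l" "n div 2 + l \<le> n"
  shows "(\<Sum>j<l. n choose (n div 2 + j)) \<le> La_star_R n P r"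
proof -
  let ?m = "n div 2"
  let ?F = "{A \<in> Pow {1..n}. ?m \<le> card A \<and> card A < ?m + l}"
  have "{i. i \<le> n \<and> ?m \<le> i \<and> i < ?m + l} = {0 + ?m..<l + ?m}" using assms(3) by auto
  then have "card ?F = (\<Sum>i\<in>{0 + ?m..<l + ?m}. n choose i)"
    using card_subsets_by_card[of n "\<lambda>i. ?m \<le> i \<and> i < ?m + l"] by simp
  also have "\<dots> = (\<Sum>j<l. n choose (?m + j))"
    by (subst sum.shift_bounds_nat_ivl) (simp add: atLeast0LessThan add.commute)
  finally have "(\<Sum>j<l. n choose (?m + j)) = card ?F" by simp
  also have "\<dots> \<le> La_star_R n P r"
  proof (rule La_star_R_ge)
    show "proper_family_coloring ?F card"
      unfolding proper_family_coloring_def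
    proof (intro ballI impI)
      fix A B assume "A \<in> ?F" "B \<in> ?F" "A \<subset> B"
      moreover from this have "finite B" using finite_subset[of B "{1..n}"] by auto
      ultimately have "card A < card B" by (intro psubset_card_mono)
      then show "card A \<noteq> card B" by simp
    qed
    show "\<not> has_rainbow_copy P r ?F card"
    proof
      assume "has_rainbow_copy P r ?F card"
      then obtain G f where G: "G \<subseteq> ?F" "inj_on card G" "bij_betw f P G"
        unfolding has_rainbow_copy_def poset_copy_def by (elim exE conjE)
      have "card G = card (card ` G)" using G(2) by (simp add: card_image)
      also have "\<dots> \<le> card {?m..<?m + l}" using G(1) by (intro card_mono) auto
      finally show False using bij_betw_same_card[OF G(3)] assms(2) by simp
    qed
  qed auto
  finally show ?thesis .
qed

text \<open>Consecutive coefficients have the quotient \<open>(n - i) / (i + 1)\<close>, which tends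
  to 1 for \<open>i = n div 2 + j\<close>; the floor is handled by keeping \<open>n div 2\<close>
  between \<open>n / 2 - 1 / 2\<close> and \<open>n / 2\<close>.\<close>

lemma tendsto_binomial_near_middle:
  "(\<lambda>n. real (n choose (n div 2 + j)) / real (n choose (n div 2))) \<longlonglongrightarrow> 1"
proof (induction j)
  case 0
  have "\<not> n < n div 2" for n :: nat by linarith
  then show ?case by simp
next
  case (Suc j)
  let ?q = "\<lambda>n. real (n - (n div 2 + j)) / real (Suc (n div 2 + j))"
  have "?q \<longlonglongrightarrow> 1"
  proof (rule real_tendsto_sandwich)
    show "eventually (\<lambda>n. (real n / 2 - real j) / (real n / 2 + real j + 1) \<le> ?q n) at_top"
    proof (rule always_eventually, rule allI)
      fix n :: nat
      have "real (n div 2) \<le> real n / 2" by linarith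
      then show "(real n / 2 - real j) / (real n / 2 + real j + 1) \<le> ?q n"
        by (intro frac_le) auto
    qed
    show "eventually (\<lambda>n. ?q n \<le> (real n / 2 + 1 / 2 + real j) / (real n / 2 + real j + 1 / 2)) at_top"
    proof (rule always_eventually, rule allI)
      fix n :: nat
      have "real n / 2 - 1 / 2 \<le> real (n div 2)" by linarith
      then show "?q n \<le> (real n / 2 + 1 / 2 + real j) / (real n / 2 + real j + 1 / 2)"
        by (intro frac_le) auto
    qed
    show "(\<lambda>n. (real n / 2 - real j) / (real n / 2 + real j + 1)) \<longlonglongrightarrow> 1" by real_asymp
    show "(\<lambda>n. (real n / 2 + 1 / 2 + real j) / (real n / 2 + real j + 1 / 2)) \<longlonglongrightarrow> 1" by real_asymp
  qed
  then have "(\<lambda>n. real (n choose (n div 2 + j)) / real (n choose (n div 2)) * ?q n) \<longlonglongrightarrow> 1 * 1"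
    by (intro tendsto_mult Suc.IH)
  moreover have "real (n choose (n div 2 + Suc j)) = real (n choose (n div 2 + j)) * ?q n" for n
  proof -
    have "Suc (n div 2 + j) * (n choose Suc (n div 2 + j)) = (n - (n div 2 + j)) * (n choose (n div 2 + j))"
      by (metis binomial_absorb_comp binomial_absorption)
    then have "real (Suc (n div 2 + j)) * real (n choose Suc (n div 2 + j))
      = real (n - (n div 2 + j)) * real (n choose (n div 2 + j))"
      by (metis of_nat_mult)
    then show ?thesis by (simp add: field_simps del: of_nat_Suc)
  qed
  ultimately show ?case by (simp add: mult_ac)
qed

theorem theorem1p6:
  fixes T :: "'a set" and r :: "'a rel"
  assumes "tree_poset T r"
  shows "\<exists>\<epsilon> :: nat \<Rightarrow> real. \<epsilon> \<in> o(\<lambda>_. 1) \<and>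
           (\<forall>n. real (La_star_R n T r) =
                  (real (card T) - 1 + \<epsilon> n) * real (n choose (n div 2)))"
proof -
  let ?b = "\<lambda>n. real (n choose (n div 2))"
  \<comment> \<open>The exact error term: the equation then holds for every \<open>n\<close>, and
    only convergence to 0 is left to prove.\<close>
  define \<epsilon> where "\<epsilon> = (\<lambda>n. real (La_star_R n T r) / ?b n - (real (card T) - 1))"
  have b: "0 < ?b n" for n by simp
  have T: "finite T" "T \<noteq> {}"
    using assms by (auto simp: tree_poset_def ugraph_tree_def ugraph_connected_def)
  then obtain l where l: "card T = Suc l" by (cases "card T") auto
  have upper: "eventually (\<lambda>n. \<epsilon> n < e) at_top" if "0 < e" for e
  proof -
    \<comment> \<open>Halving leaves room for the strict inequality, and the cap meets the
      hypothesis \<open>\<epsilon> \<le> 1\<close> of \<open>family_upper_bound\<close>.\<close>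
    define e' where "e' = min 1 (e / 2)"
    have "0 < e'" "e' \<le> 1" "e' < e" using that by (auto simp: e'_def)
    with family_upper_bound[OF assms, of e', where 'c = nat]
    have "eventually (\<lambda>n. \<forall>F (c :: nat set \<Rightarrow> nat). F \<subseteq> Pow {1..n} \<longrightarrow> proper_family_coloring F c \<longrightarrow>
      \<not> has_rainbow_copy T r F c \<longrightarrow> real (card F) \<le> (real (card T) - 1 + e') * ?b n) at_top" by blast
    then show ?thesis
    proof eventually_elim
      case (elim n)
      obtain F and c :: "nat set \<Rightarrow> nat" where "F \<subseteq> Pow {1..n}" "proper_family_coloring F c"
        "\<not> has_rainbow_copy T r F c" "La_star_R n T r = card F"
        using La_star_R_attained[OF T(2)] by metis
      then have "real (La_star_R n T r) \<le> (real (card T) - 1 + e') * ?b n" using elim by simp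
      then have "real (La_star_R n T r) / ?b n \<le> real (card T) - 1 + e'"
        using b[of n] by (simp add: pos_divide_le_eq)
      then show ?case using \<open>e' < e\<close> by (simp add: \<epsilon>_def)
    qed
  qed
  have lower: "eventually (\<lambda>n. e < \<epsilon> n) at_top" if "e < 0" for e
  proof -
    \<comment> \<open>Each of the \<open>l = card T - 1\<close> layers is asymptotically as large as
      the middle one.\<close>
    have "(\<lambda>n. \<Sum>j<l. real (n choose (n div 2 + j)) / ?b n) \<longlonglongrightarrow> (\<Sum>j<l. 1)"
      by (intro tendsto_sum tendsto_binomial_near_middle)
    then have "eventually (\<lambda>n. real l + e < (\<Sum>j<l. real (n choose (n div 2 + j)) / ?b n)) at_top"
      by (rule order_tendstoD) (use that in simp)
    then show ?thesis using eventually_ge_at_top[of "2 * l"]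
    proof eventually_elim
      case (elim n)
      have "real (\<Sum>j<l. n choose (n div 2 + j)) \<le> real (La_star_R n T r)"
        using La_star_R_ge_middle_layers[OF T(1) l, of n r] elim(2) by (simp only: of_nat_le_iff)
      then have "(\<Sum>j<l. real (n choose (n div 2 + j)) / ?b n) \<le> real (La_star_R n T r) / ?b n"
        using b[of n] by (simp add: divide_right_mono flip: sum_divide_distrib)
      then show ?case using elim(1) by (simp add: \<epsilon>_def l)
    qed
  qed
  have "\<epsilon> \<longlonglongrightarrow> 0" by (rule order_tendstoI) (use upper lower in auto)
  then have "\<epsilon> \<in> o(\<lambda>_. 1)" by (intro smalloI_tendsto) auto
  moreover have "real (La_star_R n T r) = (real (card T) - 1 + \<epsilon> n) * ?b n" for n
    using b[of n] by (simp add: \<epsilon>_def)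
  ultimately show ?thesis by blast
qed

end
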